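(* Let $(\Gamma,w)$ be a connected weighted graph with first Betti number equal to $b\ge 1$. Then $$h_{vol}(\Gamma,w)\cdot \mathrm{sys}(\Gamma,w)\le 2\ln(8b^3-1).$$
   Context: A graph is a finite non-oriented multigraph $\Gamma=(V,E)$ (multiple edges and loops allowed). A weighted graph $(\Gamma,w)$ is a graph $\Gamma$ with a weight function $w:E\to\mathbb{R}^+$ (positive values); it is regarded as a compact length space in which the edge $e$ has length $w(e)$. The length $l_w(\gamma)$ of a path or cycle is the sum of the weights of its edges (with multiplicity). The first Betti number is $b=|E|-|V|+1$ for connected $\Gamma$. The systole $\mathrm{sys}(\Gamma,w)$ is the infimum of $l_w(\gamma)$ over nontrivial (i.e. non-contractible) cycles $\gamma$ of $\Gamma$. Let $(\tilde\Gamma,\tilde w)$ be the universal cover with the lifted weights and $\tilde x_0\in\tilde\Gamma$ a lift of a point $x_0\in\Gamma$. The volume entropy is $$h_{vol}(\Gamma,w)=\lim_{R\to+\infty}\frac{\ln(\mathrm{Vol}_{\tilde w}B(\tilde x_0,R))}{R},$$ where $\mathrm{Vol}_{\tilde w}B(\tilde x_0,R)$ is the total length (one-dimensional volume, an edge $e$ having volume $\tilde w(e)$) of the ball of radius $R$ centered at $\tilde x_0$ in $(\tilde\Gamma,\tilde w)$; the limit exists and does not depend on $x_0$ or on its lift. *)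

theory Defs
  imports "HOL-Analysis.Analysis"
begin

text \<open>
  Non-oriented multigraphs, loops and multiple edges allowed. The two ends of an edge are
  labelled by Booleans; the labelling carries no orientation, it only makes it possible to
  distinguish the two ends of a loop. No finiteness is built in, since universal covers are
  objects of the same type.
\<close>

record ('v, 'e) multigraph =
  verts :: "'v set"
  edges :: "'e set"
  ends :: "'e \<Rightarrow> bool \<Rightarrow> 'v"

definition finite_multigraph :: "('v, 'e) multigraph \<Rightarrow> bool" where
  "finite_multigraph G \<longleftrightarrow> finite (verts G) \<and> finite (edges G) \<and>
     (\<forall>e\<in>edges G. \<forall>a. ends G e a \<in> verts G)"

definition weight_function :: "('v, 'e) multigraph \<Rightarrow> ('e \<Rightarrow> real) \<Rightarrow> bool" where
  "weight_function G w \<longleftrightarrow> (\<forall>e\<in>edges G. w e > 0)"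

text \<open>
  The dart \<open>(e, a)\<close> is the edge \<open>e\<close> traversed from its end labelled \<open>a\<close> to its other end.
\<close>

type_synonym 'e dart = "'e \<times> bool"

definition rev_dart :: "'e dart \<Rightarrow> 'e dart" where
  "rev_dart d = (fst d, \<not> snd d)"

fun walk :: "('v, 'e) multigraph \<Rightarrow> 'v \<Rightarrow> 'e dart list \<Rightarrow> 'v \<Rightarrow> bool" where
  "walk G u [] v \<longleftrightarrow> u \<in> verts G \<and> u = v"
| "walk G u ((e, a) # p) v \<longleftrightarrow>
     u \<in> verts G \<and> e \<in> edges G \<and> u = ends G e a \<and> walk G (ends G e (\<not> a)) p v"

definition walk_length :: "('e \<Rightarrow> real) \<Rightarrow> 'e dart list \<Rightarrow> real" where
  "walk_length w p = (\<Sum>(e, a)\<leftarrow>p. w e)"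

definition connected_graph :: "('v, 'e) multigraph \<Rightarrow> bool" where
  "connected_graph G \<longleftrightarrow> verts G \<noteq> {} \<and> (\<forall>u\<in>verts G. \<forall>v\<in>verts G. \<exists>p. walk G u p v)"

text \<open>Meaningful for connected graphs only.\<close>

definition betti_number :: "('v, 'e) multigraph \<Rightarrow> int" where
  "betti_number G = int (card (edges G)) - int (card (verts G)) + 1"

text \<open>
  Homotopy, relative to the endpoints, of walks starting at \<open>u\<close>: the equivalence relation
  generated by inserting and deleting a dart followed by its reverse.
\<close>

inductive homotopic_walks ::
    "('v, 'e) multigraph \<Rightarrow> 'v \<Rightarrow> 'e dart list \<Rightarrow> 'e dart list \<Rightarrow> bool"
  for G :: "('v, 'e) multigraph" and u :: 'v
where
  refl: "walk G u p v \<Longrightarrow> homotopic_walks G u p p"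
| backtrack: "walk G u (p @ d # rev_dart d # q) v \<Longrightarrow>
     homotopic_walks G u (p @ d # rev_dart d # q) (p @ q)"
| sym: "homotopic_walks G u p q \<Longrightarrow> homotopic_walks G u q p"
| trans: "homotopic_walks G u p q \<Longrightarrow> homotopic_walks G u q r \<Longrightarrow> homotopic_walks G u p r"

definition systole :: "('v, 'e) multigraph \<Rightarrow> ('e \<Rightarrow> real) \<Rightarrow> real" where
  "systole G w = Inf {walk_length w p | u p. walk G u p u \<and> \<not> homotopic_walks G u p []}"

text \<open>
  The length space of a weighted graph: \<open>(e, t)\<close> is the point of the edge \<open>e\<close> at distance \<open>t\<close>,
  measured along \<open>e\<close>, from the end labelled \<open>False\<close>. A vertex is thus represented once for every
  edge end attached to it; the representatives are at \<open>point_dist\<close> zero. Isolated vertices have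
  no representative.
\<close>

definition points :: "('v, 'e) multigraph \<Rightarrow> ('e \<Rightarrow> real) \<Rightarrow> ('e \<times> real) set" where
  "points G w = {(e, t). e \<in> edges G \<and> 0 \<le> t \<and> t \<le> w e}"

definition dist_to_end :: "('e \<Rightarrow> real) \<Rightarrow> 'e \<times> real \<Rightarrow> bool \<Rightarrow> real" where
  "dist_to_end w x a = (if a then w (fst x) - snd x else snd x)"

text \<open>
  A path between two points either stays inside a common edge, or leaves the first edge through
  one of its ends, follows a walk, and enters the second edge through one of its ends.
\<close>

definition path_lengths ::
    "('v, 'e) multigraph \<Rightarrow> ('e \<Rightarrow> real) \<Rightarrow> 'e \<times> real \<Rightarrow> 'e \<times> real \<Rightarrow> real set" where
  "path_lengths G w x y =
     (if fst x = fst y then {\<bar>snd x - snd y\<bar>} else {}) \<union>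
     {dist_to_end w x a + walk_length w p + dist_to_end w y a' | a p a'.
        walk G (ends G (fst x) a) p (ends G (fst y) a')}"

definition point_dist ::
    "('v, 'e) multigraph \<Rightarrow> ('e \<Rightarrow> real) \<Rightarrow> 'e \<times> real \<Rightarrow> 'e \<times> real \<Rightarrow> real" where
  "point_dist G w x y = Inf (path_lengths G w x y)"

definition graph_ball ::
    "('v, 'e) multigraph \<Rightarrow> ('e \<Rightarrow> real) \<Rightarrow> 'e \<times> real \<Rightarrow> real \<Rightarrow> ('e \<times> real) set" where
  "graph_ball G w x R = {y \<in> points G w. point_dist G w x y < R}"

definition graph_volume :: "('v, 'e) multigraph \<Rightarrow> ('e \<times> real) set \<Rightarrow> real" where
  "graph_volume G A = (\<Sum>\<^sub>\<infinity>e\<in>edges G. measure lborel {t. (e, t) \<in> A})"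

text \<open>
  The universal cover based at \<open>v\<close>: its vertices are the homotopy classes of walks starting
  at \<open>v\<close>. An edge \<open>e\<close> has one lift \<open>(c, e)\<close> for every class \<open>c\<close> of walks ending at \<open>ends G e False\<close>;
  this lift joins \<open>c\<close> to the class obtained by prolonging the elements of \<open>c\<close> along \<open>e\<close>.
  The covering projection is \<open>snd\<close> on edges and sends a class to the common endpoint of its walks.
\<close>

definition homotopy_class ::
    "('v, 'e) multigraph \<Rightarrow> 'v \<Rightarrow> 'e dart list \<Rightarrow> 'e dart list set" where
  "homotopy_class G v p = {q. homotopic_walks G v p q}"

definition universal_cover ::
    "('v, 'e) multigraph \<Rightarrow> 'v \<Rightarrow> ('e dart list set, 'e dart list set \<times> 'e) multigraph" where
  "universal_cover G v =
     \<lparr>verts = {homotopy_class G v p | p u. walk G v p u},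
      edges = {(homotopy_class G v p, e) | p e. e \<in> edges G \<and> walk G v p (ends G e False)},
      ends = (\<lambda>(c, e) a. if a then (\<Union>p\<in>c. homotopy_class G v (p @ [(e, False)])) else c)\<rparr>"

definition lifted_weight :: "('e \<Rightarrow> real) \<Rightarrow> 'c \<times> 'e \<Rightarrow> real" where
  "lifted_weight w = w \<circ> snd"

text \<open>
  The base point \<open>x = (e, t)\<close> is lifted to the universal cover based at \<open>ends G e False\<close>, on the
  lift of \<open>e\<close> issued from the class of the trivial walk.
\<close>

definition volume_entropy :: "('v, 'e) multigraph \<Rightarrow> ('e \<Rightarrow> real) \<Rightarrow> 'e \<times> real \<Rightarrow> real" where
  "volume_entropy G w x =
     (let v = ends G (fst x) False;
          H = universal_cover G v;
          x' = ((homotopy_class G v [], fst x), snd x)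
      in Lim at_top (\<lambda>R. ln (graph_volume H (graph_ball H (lifted_weight w) x' R)) / R))"

end

theory Submission
  imports Defs
begin

text \<open>
  Every homotopy class of walks contains exactly one reduced walk, so the volume of a ball of
  radius \<open>R\<close> of the universal cover is comparable to the number \<open>M R\<close> of reduced walks of length
  less than \<open>R\<close>. Cutting walks shows that \<open>M\<close> is submultiplicative up to a constant factor; hence
  \<open>ln (M R) / R\<close> converges, and its limit is the volume entropy.

  Let \<open>s\<close> be the systole and fix a spanning tree, outside of which there are \<open>b\<close> chords. Two
  distinct reduced walks of length less than \<open>s / 2\<close> with the same ends would form a
  non-contractible cycle shorter than \<open>s\<close>. Therefore at most \<open>2 b + 1\<close> reduced walks of length less
  than \<open>s / 2\<close> issued from a given vertex are empty or end with a chord. Cut a reduced walk after its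
  longest prefix of this kind, then after the next chord (\<open>2 b\<close> choices; the tree walk in between is
  determined by its ends): the piece removed has length at least \<open>s / 2\<close>. So \<open>M\<close> is multiplied by at
  most \<open>(2 b + 1) (2 b)\<close> when \<open>R\<close> grows by \<open>s / 2\<close>, and \<open>(2 b + 1) (2 b) \<le> 8 b\<^sup>3 - 1\<close>.
\<close>

section \<open>Reduced walks\<close>

lemma rev_dart_rev_dart [simp]: "rev_dart (rev_dart d) = d"
  by (simp add: rev_dart_def)

lemma fst_rev_dart [simp]: "fst (rev_dart d) = fst d"
  by (simp add: rev_dart_def)

definition inv_walk :: "'e dart list \<Rightarrow> 'e dart list" where
  "inv_walk p = rev (map rev_dart p)"

lemma inv_walk_simps [simp]:
  "inv_walk [] = []" "inv_walk (d # p) = inv_walk p @ [rev_dart d]"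
  by (simp_all add: inv_walk_def)

lemma inv_walk_inv_walk [simp]: "inv_walk (inv_walk p) = p"
  by (simp add: inv_walk_def rev_map comp_def)

lemma fst_set_inv_walk [simp]: "fst ` set (inv_walk p) = fst ` set p"
  by (induction p) auto

abbreviation reduced :: "'e dart list \<Rightarrow> bool" where
  "reduced \<equiv> successively (\<lambda>d d'. d' \<noteq> rev_dart d)"

text \<open>Left multiplication by \<open>d\<close> on reduced words in the free group on the edges,
  where \<open>(e, True)\<close> is the inverse of \<open>(e, False)\<close>. Folding it from the
  right gives the normal form \<open>reduce\<close>.\<close>

definition push_dart :: "'e dart \<Rightarrow> 'e dart list \<Rightarrow> 'e dart list" where
  "push_dart d p = (if p \<noteq> [] \<and> hd p = rev_dart d then tl p else d # p)"

definition reduce :: "'e dart list \<Rightarrow> 'e dart list" where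
  "reduce p = foldr push_dart p []"

lemma reduce_Nil [simp]: "reduce [] = []"
  and reduce_Cons: "reduce (d # p) = push_dart d (reduce p)"
  by (simp_all add: reduce_def)

lemma reduced_push_dart: "reduced p \<Longrightarrow> reduced (push_dart d p)"
  by (cases p) (auto simp: push_dart_def successively_Cons)

lemma reduced_reduce [simp]: "reduced (reduce p)"
  by (induction p) (auto simp: reduce_Cons reduced_push_dart)

lemma reduce_reduced: "reduced p \<Longrightarrow> reduce p = p"
  by (induction p) (auto simp: reduce_Cons push_dart_def successively_Cons)

text \<open>If the inner push cancels the head of \<open>p\<close>, reducedness of \<open>p\<close>
  prevents the outer push from cancelling again. This takes the place of a confluence argument for
  free reduction.\<close>

lemma push_dart_rev_dart:
  assumes "reduced p" shows "push_dart d (push_dart (rev_dart d) p) = p"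
  using assms by (cases p) (auto simp: push_dart_def successively_Cons)

text \<open>Dart words act on reduced words through \<open>push_dart\<close>. A dart followed by its
  reverse acts trivially, so a word and its reduction act in the same way.\<close>

lemma foldr_push_dart_reduce:
  assumes "reduced q" shows "foldr push_dart (reduce p) q = foldr push_dart p q"
proof (induction p)
  case (Cons d p)
  have red: "reduced (foldr push_dart r q)" for r
    by (induction r) (auto simp: assms reduced_push_dart)
  show ?case
  proof (cases "reduce p \<noteq> [] \<and> hd (reduce p) = rev_dart d")
    case True
    then obtain r where r: "reduce p = rev_dart d # r" by (cases "reduce p") auto
    \<comment> \<open>The cancelled pair is put back, so that the action of all of
      \<open>reduce p\<close> appears and the induction hypothesis applies.\<close>
    have "foldr push_dart r q = push_dart d (push_dart (rev_dart d) (foldr push_dart r q))"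
      by (simp add: push_dart_rev_dart red)
    then show ?thesis using Cons r by (simp add: reduce_Cons push_dart_def[of d "rev_dart d # r"])
  next
    case False
    then show ?thesis using Cons by (auto simp: reduce_Cons push_dart_def[of d "reduce p"])
  qed
qed simp

lemma reduce_append: "reduce (p @ q) = foldr push_dart p (reduce q)"
  by (simp add: reduce_def)

lemma reduce_append_left [simp]: "reduce (reduce p @ q) = reduce (p @ q)"
  by (simp add: reduce_append foldr_push_dart_reduce)

lemma reduce_append_right [simp]: "reduce (p @ reduce q) = reduce (p @ q)"
  by (simp add: reduce_append reduce_reduced)

lemma reduce_append_cong:
  "reduce p = reduce p' \<Longrightarrow> reduce q = reduce q' \<Longrightarrow> reduce (p @ q) = reduce (p' @ q')"
  by (metis reduce_append_left reduce_append_right)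

lemma reduce_backtrack: "reduce (p @ d # rev_dart d # q) = reduce (p @ q)"
  by (simp add: reduce_append reduce_Cons push_dart_rev_dart)

lemma reduce_inv_walk_cancel [simp]: "reduce (inv_walk q @ q @ p) = reduce p"
proof (induction q arbitrary: p)
  case (Cons d q)
  show ?case using reduce_backtrack[of "inv_walk q" "rev_dart d" "q @ p"] Cons by simp
qed simp

lemma reduce_append_cancel:
  assumes "reduce (q @ p) = reduce (q @ p')" shows "reduce p = reduce p'"
  using reduce_append_cong[OF HOL.refl assms, of "inv_walk q"] by simp

text \<open>The word \<open>p @ inv_walk q @ q\<close> is reduced in two ways: its first two blocks
  cancel by hypothesis and leave \<open>q\<close>, its last two cancel and leave
  \<open>p\<close>.\<close>

lemma reduced_eqI_reduce_inv:
  assumes "reduced p" "reduced q" "reduce (p @ inv_walk q) = []"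
  shows "p = q"
proof -
  have "reduce ((p @ inv_walk q) @ q) = reduce ([] @ q)"
    using assms(3) by (intro reduce_append_cong) auto
  moreover have "reduce (p @ inv_walk q @ q) = reduce (p @ [])"
    using reduce_inv_walk_cancel[of q "[]"] by (intro reduce_append_cong) auto
  ultimately show ?thesis using assms by (simp add: reduce_reduced)
qed

lemma set_push_dart: "set (push_dart d p) \<subseteq> insert d (set p)"
  by (cases p) (auto simp: push_dart_def)

lemma set_reduce: "set (reduce p) \<subseteq> set p"
proof (induction p)
  case (Cons d p)
  then show ?case using set_push_dart[of d "reduce p"] by (auto simp: reduce_Cons)
qed simp

lemma walk_length_simps [simp]:
  "walk_length w [] = 0" "walk_length w (d # p) = w (fst d) + walk_length w p"
  "walk_length w (p @ q) = walk_length w p + walk_length w q"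
  by (auto simp: walk_length_def split: prod.split)

lemma walk_length_inv_walk [simp]: "walk_length w (inv_walk p) = walk_length w p"
  by (induction p) auto

lemma walk_length_nonneg: "(\<And>d. d \<in> set p \<Longrightarrow> 0 \<le> w (fst d)) \<Longrightarrow> 0 \<le> walk_length w p"
  by (induction p) auto

lemma walk_length_reduce:
  assumes "\<And>d. d \<in> set p \<Longrightarrow> 0 \<le> w (fst d)"
  shows "walk_length w (reduce p) \<le> walk_length w p"
  using assms
proof (induction p)
  case (Cons d p)
  have IH: "walk_length w (reduce p) \<le> walk_length w p" using Cons by auto
  have "walk_length w (push_dart d (reduce p)) \<le> w (fst d) + walk_length w (reduce p)"
  proof (cases "reduce p")
    case (Cons d' r)
    moreover have "0 \<le> w (fst d')" using Cons set_reduce[of p] Cons.prems by auto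
    ultimately show ?thesis using Cons.prems[of d] by (auto simp: push_dart_def)
  qed (simp add: push_dart_def)
  then show ?case using IH by (simp add: reduce_Cons)
qed simp

section \<open>Walks and their homotopy classes\<close>

lemma walk_start: "walk G u p v \<Longrightarrow> u \<in> verts G"
  by (cases p) auto

lemma walk_Cons:
  "walk G u (d # p) v \<longleftrightarrow> u \<in> verts G \<and> fst d \<in> edges G \<and> u = ends G (fst d) (snd d) \<and>
     walk G (ends G (fst d) (\<not> snd d)) p v"
  by (cases d) auto

lemma walk_append: "walk G u (p @ q) v \<longleftrightarrow> (\<exists>m. walk G u p m \<and> walk G m q v)"
  by (induction p arbitrary: u) (auto simp: walk_Cons dest: walk_start)

lemma walk_appendI: "walk G u p m \<Longrightarrow> walk G m q v \<Longrightarrow> walk G u (p @ q) v"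
  unfolding walk_append by blast

lemma walk_end: "walk G u p v \<Longrightarrow> v \<in> verts G"
  by (induction p arbitrary: u) (auto simp: walk_Cons)

lemma walk_unique: "walk G u p v \<Longrightarrow> walk G u p v' \<Longrightarrow> v = v'"
  by (induction p arbitrary: u) (auto simp: walk_Cons)

lemma walk_edges: "walk G u p v \<Longrightarrow> fst ` set p \<subseteq> edges G"
  by (induction p arbitrary: u) (auto simp: walk_Cons)

lemma walk_last:
  "walk G u p v \<Longrightarrow> p \<noteq> [] \<Longrightarrow> v = ends G (fst (last p)) (\<not> snd (last p))"
  by (induction p arbitrary: u) (auto simp: walk_Cons split: if_splits)

lemma walk_inv_walk: "walk G u p v \<Longrightarrow> walk G v (inv_walk p) u"
proof (induction p arbitrary: u)
  case (Cons d p)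
  let ?m = "ends G (fst d) (\<not> snd d)"
  have p: "walk G ?m p v" using Cons.prems by (simp add: walk_Cons)
  have "walk G ?m [rev_dart d] u"
    using Cons.prems walk_start[OF p] by (auto simp: walk_Cons rev_dart_def)
  then show ?case using Cons.IH[OF p] by (auto simp: walk_append)
qed simp

lemma walk_push_dart:
  assumes "walk G u (d # p) v" shows "walk G u (push_dart d p) v"
proof (cases "p \<noteq> [] \<and> hd p = rev_dart d")
  case True
  then obtain r where "p = rev_dart d # r" by (cases p) auto
  with assms show ?thesis by (simp add: push_dart_def walk_Cons rev_dart_def)
next
  case False
  with assms show ?thesis by (auto simp: push_dart_def)
qed

lemma walk_reduce: "walk G u p v \<Longrightarrow> walk G u (reduce p) v"
  by (induction p arbitrary: u) (auto simp: reduce_Cons walk_Cons intro!: walk_push_dart)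

lemma homotopic_walks_invariants:
  "homotopic_walks G u p q \<Longrightarrow>
     reduce p = reduce q \<and> (\<exists>v. walk G u p v) \<and> (\<forall>v. walk G u p v \<longleftrightarrow> walk G u q v)"
proof (induction rule: homotopic_walks.induct)
  case (backtrack p d q v)
  have "walk G u (p @ d # rev_dart d # q) v' \<Longrightarrow> walk G u (p @ q) v'" for v'
    by (force simp: walk_append walk_Cons rev_dart_def)
  \<comment> \<open>For the converse, both walks are known to end at \<open>v\<close>, and the end
    of a walk is unique.\<close>
  then have "walk G u (p @ d # rev_dart d # q) v' \<longleftrightarrow> walk G u (p @ q) v'" for v'
    using backtrack by (blast dest: walk_unique)
  then show ?case using backtrack by (auto simp: reduce_backtrack)
qed auto

lemma homotopic_walks_Cons:
  "homotopic_walks G (ends G (fst d) (\<not> snd d)) p q \<Longrightarrow> fst d \<in> edges G \<Longrightarrow>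
     ends G (fst d) (snd d) \<in> verts G \<Longrightarrow>
     homotopic_walks G (ends G (fst d) (snd d)) (d # p) (d # q)"
proof (induction rule: homotopic_walks.induct)
  case (refl p v)
  then show ?case by (intro homotopic_walks.refl[where v = v]) (auto simp: walk_Cons)
next
  case (backtrack p d' q v)
  then have "homotopic_walks G (ends G (fst d) (snd d)) ((d # p) @ d' # rev_dart d' # q) ((d # p) @ q)"
    by (intro homotopic_walks.backtrack[where v = v]) (auto simp: walk_Cons)
  then show ?case by simp
qed (auto intro: homotopic_walks.sym homotopic_walks.trans)

lemma homotopic_walks_reduce: "walk G u p v \<Longrightarrow> homotopic_walks G u p (reduce p)"
proof (induction p arbitrary: u)
  case Nil
  then show ?case by (auto intro: homotopic_walks.refl[where v = v])
next
  case (Cons d p)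
  then have 1: "homotopic_walks G u (d # p) (d # reduce p)"
    by (auto simp: walk_Cons intro!: homotopic_walks_Cons)
  have 2: "walk G u (d # reduce p) v" using Cons.prems walk_reduce by (auto simp: walk_Cons)
  have "homotopic_walks G u (d # reduce p) (push_dart d (reduce p))"
  proof (cases "reduce p \<noteq> [] \<and> hd (reduce p) = rev_dart d")
    case True
    then obtain r where r: "reduce p = rev_dart d # r" by (cases "reduce p") auto
    show ?thesis using homotopic_walks.backtrack[of G u "[]" d r v] 2
      by (simp add: r push_dart_def)
  next
    case False
    then show ?thesis using 2 by (auto simp: push_dart_def intro: homotopic_walks.refl)
  qed
  then show ?case using 1 by (auto simp: reduce_Cons intro: homotopic_walks.trans)
qed

text \<open>A walk is homotopic to its reduction, so end and reduction form a complete invariant of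
  homotopy. From here on, homotopy is handled by computing with \<open>reduce\<close>.\<close>

lemma homotopic_walks_iff:
  assumes "walk G u p v"
  shows "homotopic_walks G u p q \<longleftrightarrow> walk G u q v \<and> reduce p = reduce q"
proof
  assume "homotopic_walks G u p q"
  from homotopic_walks_invariants[OF this] assms
  show "walk G u q v \<and> reduce p = reduce q" by auto
next
  assume q: "walk G u q v \<and> reduce p = reduce q"
  then have "homotopic_walks G u (reduce p) q"
    using homotopic_walks.sym[OF homotopic_walks_reduce[of G u q v]] by simp
  with homotopic_walks_reduce[OF assms] show "homotopic_walks G u p q"
    by (rule homotopic_walks.trans)
qed

lemma homotopy_class_eq:
  assumes "walk G u p v"
  shows "homotopy_class G u p = {q. walk G u q v \<and> reduce p = reduce q}"
  unfolding homotopy_class_def homotopic_walks_iff[OF assms] ..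

lemma homotopy_class_eq_iff:
  assumes "walk G u p v" "walk G u q v'"
  shows "homotopy_class G u p = homotopy_class G u q \<longleftrightarrow> reduce p = reduce q"
proof
  assume "homotopy_class G u p = homotopy_class G u q"
  then show "reduce p = reduce q"
    unfolding homotopy_class_eq[OF assms(1)] homotopy_class_eq[OF assms(2)] using assms by blast
next
  assume *: "reduce p = reduce q"
  then have "v = v'"
    using walk_reduce[OF assms(1)] walk_reduce[OF assms(2)] by (auto dest: walk_unique)
  with * show "homotopy_class G u p = homotopy_class G u q"
    unfolding homotopy_class_eq[OF assms(1)] homotopy_class_eq[OF assms(2)] by simp
qed

section \<open>Spanning trees\<close>

text \<open>The dart sought is the first one that leaves \<open>S\<close>. It supplies the edge by
  which a tree on the vertices \<open>S\<close> is extended.\<close>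

lemma walk_crosses:
  "walk G u p v \<Longrightarrow> u \<in> S \<Longrightarrow> v \<notin> S \<Longrightarrow>
     \<exists>e a. e \<in> edges G \<and> ends G e a \<in> S \<and> ends G e (\<not> a) \<in> verts G - S"
proof (induction p arbitrary: u)
  case (Cons d p)
  let ?m = "ends G (fst d) (\<not> snd d)"
  from Cons.prems have d: "fst d \<in> edges G" "ends G (fst d) (snd d) \<in> S" and p: "walk G ?m p v"
    by (auto simp: walk_Cons)
  show ?case
  proof (cases "?m \<in> S")
    case True
    with Cons.IH p Cons.prems(3) show ?thesis by blast
  next
    case False
    with d walk_start[OF p] show ?thesis by blast
  qed
qed simp

text \<open>
  A spanning tree is given with a walk \<open>q v\<close> from the root to every vertex \<open>v\<close>; acyclicity is
  expressed by the compatibility of these walks with the tree edges, which is stable under the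
  adjunction of a leaf.
\<close>

lemma growing_tree:
  assumes "finite_multigraph G" "connected_graph G" "1 \<le> n" "n \<le> card (verts G)"
  shows "\<exists>S F (q :: 'v \<Rightarrow> 'e dart list). S \<subseteq> verts (G :: ('v, 'e) multigraph) \<and> card S = n \<and>
    F \<subseteq> edges G \<and> card F + 1 = n \<and> (\<forall>e\<in>F. \<forall>a. ends G e a \<in> S) \<and>
    (\<forall>e\<in>F. reduce (q (ends G e False) @ [(e, False)]) = reduce (q (ends G e True)))"
  using assms(3,4)
proof (induction n rule: dec_induct)
  case base
  obtain v where "v \<in> verts G" using assms(2) by (auto simp: connected_graph_def)
  then show ?case by (intro exI[of _ "{v}"] exI[of _ "{}"]) auto
next
  case (step n)
  then obtain S F and q :: "'v \<Rightarrow> 'e dart list" where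
    S: "S \<subseteq> verts G" "card S = n" and F: "F \<subseteq> edges G" "card F + 1 = n"
      "\<forall>e\<in>F. \<forall>a. ends G e a \<in> S"
    and q: "\<forall>e\<in>F. reduce (q (ends G e False) @ [(e, False)]) = reduce (q (ends G e True))"
    by (metis Suc_leD)
  have fin: "finite S" "finite F"
    using S F assms(1) finite_subset by (auto simp: finite_multigraph_def)
  obtain u where u: "u \<in> S" using S step.hyps by fastforce
  obtain v where v: "v \<in> verts G" "v \<notin> S"
    using S step.prems by (metis Suc_n_not_le_n subsetI subset_antisym)
  obtain p where "walk G u p v" using assms(2) u v S by (meson connected_graph_def subsetD)
  then obtain e a where e: "e \<in> edges G" "ends G e a \<in> S" "ends G e (\<not> a) \<in> verts G - S"
    using walk_crosses u v by metis
  let ?z = "ends G e (\<not> a)"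
  \<comment> \<open>The walk to the new leaf \<open>?z\<close> goes to the old end of
    \<open>e\<close> and then crosses \<open>e\<close>.\<close>
  let ?q = "q(?z := q (ends G e a) @ [(e, a)])"
  have "e \<notin> F" using F(3) e(3) by (metis DiffD2)
  have ne: "ends G e a \<noteq> ?z" using e by auto
  have "reduce (?q (ends G e False) @ [(e, False)]) = reduce (?q (ends G e True))"
  proof (cases a)
    \<comment> \<open>Here the new leaf is the end \<open>False\<close> of \<open>e\<close>, so that
      following \<open>e\<close> from it retraces the last dart of \<open>?q ?z\<close>.\<close>
    case True
    then show ?thesis using ne reduce_backtrack[of "q (ends G e True)" "(e, True)" "[]"]
      by (simp add: rev_dart_def)
  next
    case False
    then show ?thesis using ne by simp
  qed
  moreover have "reduce (?q (ends G f False) @ [(f, False)]) = reduce (?q (ends G f True))"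
    if "f \<in> F" for f
  proof -
    \<comment> \<open>Both ends of an old edge lie in \<open>S\<close>, where \<open>?q\<close>
      agrees with \<open>q\<close>.\<close>
    have "ends G f c \<in> S" for c using F(3) that by blast
    then have "ends G f c \<noteq> ?z" for c using e(3) by (metis DiffD2)
    then show ?thesis using q that by simp
  qed
  ultimately have "\<forall>f\<in>insert e F. reduce (?q (ends G f False) @ [(f, False)]) = reduce (?q (ends G f True))"
    by blast
  moreover have "\<forall>f\<in>insert e F. \<forall>c. ends G f c \<in> insert ?z S"
  proof (intro ballI allI)
    fix f c assume f: "f \<in> insert e F"
    show "ends G f c \<in> insert ?z S"
    proof (cases "f = e")
      case True
      then show ?thesis using e(2) by (cases "c = a") auto
    next
      case False
      then show ?thesis using f F(3) by blast
    qed
  qed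
  moreover have "card (insert ?z S) = Suc n" "card (insert e F) + 1 = Suc n"
    using S F e fin \<open>e \<notin> F\<close> by auto
  moreover have "insert ?z S \<subseteq> verts G" "insert e F \<subseteq> edges G" using S F e by auto
  ultimately show ?case
    by (intro exI[of _ "insert ?z S"] exI[of _ "insert e F"] exI[of _ ?q] conjI)
qed

text \<open>The words \<open>q u\<close> act as a potential: crossing a tree dart multiplies the
  potential on the right by that dart, and the product telescopes along the walk.\<close>

lemma tree_walk_reduce:
  assumes "\<forall>e\<in>F. reduce (q (ends G e False) @ [(e, False)]) = reduce (q (ends G e True))"
    and "walk G u p v" "fst ` set p \<subseteq> F"
  shows "reduce (q u @ p) = reduce (q v)"
  using assms(2,3)
proof (induction p arbitrary: u)
  case (Cons d p)
  obtain e a where d: "d = (e, a)" by (cases d)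
  have step: "reduce (q (ends G e a) @ [(e, a)]) = reduce (q (ends G e (\<not> a)))"
  proof (cases a)
    case True
    have "reduce (q (ends G e True) @ [(e, True)]) =
        reduce ((q (ends G e False) @ [(e, False)]) @ [(e, True)])"
      using assms(1) Cons.prems d by (intro reduce_append_cong) auto
    also have "\<dots> = reduce (q (ends G e False))"
      using reduce_backtrack[of "q (ends G e False)" "(e, False)" "[]"] by (simp add: rev_dart_def)
    finally show ?thesis using True by simp
  qed (use assms(1) Cons.prems d in auto)
  have "reduce (q u @ d # p) = reduce ((q (ends G e a) @ [(e, a)]) @ p)"
    using Cons.prems d by (simp add: walk_Cons)
  also have "\<dots> = reduce (q (ends G e (\<not> a)) @ p)"
    using step by (intro reduce_append_cong) auto
  also have "\<dots> = reduce (q v)" using Cons d by (auto simp: walk_Cons)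
  finally show ?case .
qed simp

text \<open>For a closed walk \<open>p\<close> of tree edges the potential is the same word at both
  ends. Cancelling it shows that \<open>p\<close> reduces to the empty word.\<close>

lemma spanning_tree:
  assumes "finite_multigraph G" "connected_graph G"
  obtains F where "F \<subseteq> edges G" "card F + 1 = card (verts G)"
    "\<And>u p. walk G u p u \<Longrightarrow> reduced p \<Longrightarrow> fst ` set p \<subseteq> F \<Longrightarrow> p = []"
proof -
  have "1 \<le> card (verts G)"
    using assms by (auto simp: connected_graph_def finite_multigraph_def Suc_le_eq card_gt_0_iff)
  from growing_tree[OF assms this] obtain F and q :: "'a \<Rightarrow> 'b dart list" where
    F: "F \<subseteq> edges G" "card F + 1 = card (verts G)"
    and q: "\<forall>e\<in>F. reduce (q (ends G e False) @ [(e, False)]) = reduce (q (ends G e True))"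
    by auto
  show thesis
  proof (rule that[OF F])
    fix u p assume p: "walk G u p u" "reduced p" "fst ` set p \<subseteq> F"
    from tree_walk_reduce[OF q p(1,3)] have "reduce (q u @ p) = reduce (q u @ [])" by simp
    from reduce_append_cancel[OF this] show "p = []" using p by (simp add: reduce_reduced)
  qed
qed

section \<open>Counting reduced walks\<close>

lemma split_at_length:
  assumes "0 < R" "R \<le> walk_length w p"
  shows "\<exists>p1 d p2. p = p1 @ d # p2 \<and> walk_length w p1 < R \<and> R \<le> walk_length w (p1 @ [d])"
  using assms(2)
proof (induction p rule: rev_induct)
  case (snoc d p)
  show ?case
  proof (cases "R \<le> walk_length w p")
    case True
    then obtain p1 d' p2 where "p = p1 @ d' # p2" "walk_length w p1 < R"
      "R \<le> walk_length w (p1 @ [d'])" using snoc.IH by blast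
    then show ?thesis by (intro exI[of _ p1] exI[of _ d'] exI[of _ "p2 @ [d]"]) simp
  next
    case False
    with snoc.prems show ?thesis by (intro exI[of _ p] exI[of _ d] exI[of _ "[]"]) simp
  qed
qed (use assms in simp)

lemma split_trailing:
  "\<exists>p1 q. p = p1 @ q \<and> (p1 = [] \<or> fst (last p1) \<notin> F) \<and> fst ` set q \<subseteq> F"
proof (induction p rule: rev_induct)
  case (snoc d p)
  then obtain p1 q where *: "p = p1 @ q" "p1 = [] \<or> fst (last p1) \<notin> F" "fst ` set q \<subseteq> F"
    by blast
  show ?case
  proof (cases "fst d \<in> F")
    case True
    then show ?thesis using * by (intro exI[of _ p1] exI[of _ "q @ [d]"]) simp
  next
    case False
    then show ?thesis by (intro exI[of _ "p @ [d]"] exI[of _ "[]"]) simp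
  qed
qed simp

text \<open>The walk is scanned chord by chord, a chord being an edge outside \<open>F\<close>:
  \<open>p1\<close> has been read and \<open>q\<close> remains. The scan stops at the first chord
  \<open>f\<close> that brings the length to at least \<open>r\<close>. A nonempty \<open>q\<close>
  ends with a chord, so there is always a next one until then.\<close>

lemma split_greedy:
  assumes "p1 = [] \<or> fst (last p1) \<notin> F" "walk_length w p1 < r" "q = [] \<or> fst (last q) \<notin> F"
    and "r \<le> walk_length w (p1 @ q)"
  shows "\<exists>p t f q'. p1 @ q = p @ t @ f # q' \<and> (p = [] \<or> fst (last p) \<notin> F) \<and>
    walk_length w p < r \<and> fst ` set t \<subseteq> F \<and> fst f \<notin> F \<and> r \<le> walk_length w (p @ t @ [f]) \<and>
    (q' = [] \<or> fst (last q') \<notin> F)"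
  using assms
proof (induction "length q" arbitrary: p1 q rule: less_induct)
  case less
  then have "q \<noteq> []" by auto
  then have "\<exists>d\<in>set q. fst d \<notin> F" using less.prems last_in_set by blast
  from split_list_first_prop[OF this] obtain t f q' where q: "q = t @ f # q'" "fst f \<notin> F"
    "\<forall>d\<in>set t. \<not> fst d \<notin> F" by blast
  have t: "fst ` set t \<subseteq> F" using q by auto
  have q': "q' = [] \<or> fst (last q') \<notin> F" using less.prems q by (auto split: if_splits)
  show ?case
  proof (cases "r \<le> walk_length w (p1 @ t @ [f])")
    case True
    then show ?thesis using less.prems q t q'
      by (intro exI[of _ p1] exI[of _ t] exI[of _ f] exI[of _ q']) simp
  next
    case False
    have "\<exists>p t' f' q''. (p1 @ t @ [f]) @ q' = p @ t' @ f' # q'' \<and>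
      (p = [] \<or> fst (last p) \<notin> F) \<and> walk_length w p < r \<and> fst ` set t' \<subseteq> F \<and> fst f' \<notin> F \<and>
      r \<le> walk_length w (p @ t' @ [f']) \<and> (q'' = [] \<or> fst (last q'') \<notin> F)"
    proof (rule less.hyps)
      show "length q' < length q" using q by simp
      show "r \<le> walk_length w ((p1 @ t @ [f]) @ q')" using less.prems q by simp
    qed (use q q' False in auto)
    then show ?thesis using q by simp
  qed
qed

lemma finite_card_le_1:
  assumes "\<And>x y. x \<in> A \<Longrightarrow> y \<in> A \<Longrightarrow> x = y" shows "finite A \<and> card A \<le> 1"
proof (cases "A = {}")
  case False
  then obtain x where "A = {x}" using assms by blast
  then show ?thesis by simp
qed simp

text \<open>The explicit form of \<open>c\<close> is kept so that its edges and its length can be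
  compared with those of \<open>p\<close> and \<open>q\<close>.\<close>

lemma reduced_closed_walk_of_two:
  assumes "walk G u p v" "walk G u q v" "reduced p" "reduced q" "p \<noteq> q"
  shows "\<exists>c. walk G u c u \<and> reduced c \<and> c \<noteq> [] \<and> c = reduce (p @ inv_walk q)"
proof -
  have "walk G u (p @ inv_walk q) u"
    using assms(1) walk_inv_walk[OF assms(2)] unfolding walk_append by blast
  from walk_reduce[OF this] show ?thesis using assms reduced_eqI_reduce_inv by auto
qed

section \<open>Finiteness and submultiplicativity of the number of reduced walks\<close>

locale weighted_multigraph =
  fixes G :: "('v, 'e) multigraph" and w :: "'e \<Rightarrow> real"
  assumes finite_multigraph: "finite_multigraph G" and weight_function: "weight_function G w"
begin

lemma finite_verts: "finite (verts G)" and finite_edges: "finite (edges G)"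
  using finite_multigraph by (auto simp: finite_multigraph_def)

lemma weight_pos: "e \<in> edges G \<Longrightarrow> 0 < w e"
  using weight_function by (simp add: weight_function_def)

lemma ends_in_verts: "e \<in> edges G \<Longrightarrow> ends G e a \<in> verts G"
  using finite_multigraph unfolding finite_multigraph_def by blast

lemma walk_weight_nonneg: "walk G u p v \<Longrightarrow> d \<in> set p \<Longrightarrow> 0 \<le> w (fst d)"
  using walk_edges[of G u p v] by (simp add: image_subset_iff less_imp_le weight_pos)

lemma walk_length_walk_nonneg: "walk G u p v \<Longrightarrow> 0 \<le> walk_length w p"
  using walk_weight_nonneg by (blast intro: walk_length_nonneg)

lemma walk_length_reduce_le: "walk G u p v \<Longrightarrow> walk_length w (reduce p) \<le> walk_length w p"
  using walk_weight_nonneg by (blast intro: walk_length_reduce)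

definition rwalks :: "'v \<Rightarrow> real \<Rightarrow> 'e dart list set" where
  "rwalks u R = {p. reduced p \<and> (\<exists>v. walk G u p v) \<and> walk_length w p < R}"

text \<open>Starting vertices are taken together because the second piece of a cut walk starts at
  another vertex than the first.\<close>

definition all_rwalks :: "real \<Rightarrow> 'e dart list set" where
  "all_rwalks R = (\<Union>u\<in>verts G. rwalks u R)"

lemma rwalks_subset_all: "rwalks u R \<subseteq> all_rwalks R"
  by (auto simp: rwalks_def all_rwalks_def dest: walk_start)

lemma min_weight: "\<exists>m>0. \<forall>e\<in>edges G. m \<le> w e"
proof (intro exI conjI ballI)
  \<comment> \<open>The inserted 1 keeps the minimum meaningful for a graph without edges.\<close>
  show "0 < Min (insert 1 (w ` edges G))" using finite_edges weight_pos by auto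
  show "Min (insert 1 (w ` edges G)) \<le> w e" if "e \<in> edges G" for e
    using finite_edges that by auto
qed

lemma max_weight: "\<exists>W>0. \<forall>e\<in>edges G. w e \<le> W"
proof (intro exI conjI ballI)
  show "0 < Max (insert 1 (w ` edges G))" using finite_edges by (auto simp: Max_gr_iff)
  show "w e \<le> Max (insert 1 (w ` edges G))" if "e \<in> edges G" for e
    using finite_edges that by auto
qed

text \<open>The weights have a positive lower bound, so a bound on the length also bounds the number
  of darts.\<close>

lemma finite_all_rwalks [simp]: "finite (all_rwalks R)"
proof -
  obtain m where m: "0 < m" "\<forall>e\<in>edges G. m \<le> w e" using min_weight by blast
  have len: "m * real (length p) \<le> walk_length w p" if "walk G u p v" for u p v
    using that
  proof (induction p arbitrary: u)
    case (Cons d p)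
    then have "m * real (length p) \<le> walk_length w p" "m \<le> w (fst d)"
      using m by (auto simp: walk_Cons)
    then show ?case by (simp add: algebra_simps)
  qed simp
  have "all_rwalks R \<subseteq> {p. set p \<subseteq> edges G \<times> UNIV \<and> length p \<le> nat \<lceil>R / m\<rceil>}"
  proof
    fix p assume "p \<in> all_rwalks R"
    then obtain u v where p: "walk G u p v" "walk_length w p < R"
      by (auto simp: all_rwalks_def rwalks_def)
    have "m * real (length p) < R" using len[OF p(1)] p(2) by simp
    then have "real (length p) < R / m" using m by (simp add: field_simps)
    then have "length p \<le> nat \<lceil>R / m\<rceil>" by linarith
    then show "p \<in> {p. set p \<subseteq> edges G \<times> UNIV \<and> length p \<le> nat \<lceil>R / m\<rceil>}"
      using walk_edges[OF p(1)] by auto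
  qed
  moreover have "finite (edges G \<times> (UNIV :: bool set))" using finite_edges by simp
  ultimately show ?thesis using finite_lists_length_le finite_subset by blast
qed

lemma finite_rwalks [simp]: "finite (rwalks u R)"
  by (rule finite_subset[OF rwalks_subset_all finite_all_rwalks])

lemma card_all_rwalks_mono: "R \<le> S \<Longrightarrow> card (all_rwalks R) \<le> card (all_rwalks S)"
proof (intro card_mono finite_all_rwalks)
  assume "R \<le> S"
  then have "rwalks u R \<subseteq> rwalks u S" for u by (auto simp: rwalks_def)
  then show "all_rwalks R \<subseteq> all_rwalks S" unfolding all_rwalks_def by blast
qed

lemma card_all_rwalks_ge_1:
  assumes "verts G \<noteq> {}" "0 < R" shows "1 \<le> card (all_rwalks R)"
proof -
  obtain v where "v \<in> verts G" using assms by blast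
  then have "[] \<in> all_rwalks R" using assms by (auto simp: all_rwalks_def rwalks_def)
  then show ?thesis using card_gt_0_iff[of "all_rwalks R"] by force
qed

text \<open>A walk not shorter than \<open>R\<close> is cut around the dart with which its length
  reaches \<open>R\<close>: the part before is shorter than \<open>R\<close>, the part after is
  shorter than \<open>S\<close>. There are \<open>2 * card (edges G)\<close> choices for the dart;
  the extra 1 pays for the walks shorter than \<open>R\<close>.\<close>

lemma card_all_rwalks_add:
  assumes "verts G \<noteq> {}" "0 < R" "0 < S"
  shows "card (all_rwalks (R + S)) \<le>
    (2 * card (edges G) + 1) * (card (all_rwalks R) * card (all_rwalks S))"
proof -
  let ?D = "edges G \<times> (UNIV :: bool set)"
  let ?f = "\<lambda>(p, d, q). p @ d # q"
  have "all_rwalks (R + S) \<subseteq> all_rwalks R \<union> ?f ` (all_rwalks R \<times> ?D \<times> all_rwalks S)"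
  proof
    fix p assume "p \<in> all_rwalks (R + S)"
    then obtain u v where p: "walk G u p v" "reduced p" "walk_length w p < R + S"
      by (auto simp: all_rwalks_def rwalks_def)
    show "p \<in> all_rwalks R \<union> ?f ` (all_rwalks R \<times> ?D \<times> all_rwalks S)"
    proof (cases "walk_length w p < R")
      case True
      then have "p \<in> rwalks u R" using p by (auto simp: rwalks_def)
      then show ?thesis using rwalks_subset_all by blast
    next
      case False
      then obtain p1 d p2 where d: "p = p1 @ d # p2" "walk_length w p1 < R"
        "R \<le> walk_length w (p1 @ [d])" using split_at_length[OF assms(2)] by (meson not_less)
      obtain m where m: "walk G u p1 m" "walk G m (d # p2) v"
        using p(1) unfolding d(1) walk_append by blast
      have "p1 \<in> rwalks u R" using m p(2) d by (auto simp: rwalks_def successively_append_iff)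
      moreover have "p2 \<in> rwalks (ends G (fst d) (\<not> snd d)) S"
        using m p(2,3) d by (auto simp: rwalks_def successively_append_iff successively_Cons walk_Cons)
      moreover have "d \<in> ?D" using m by (cases d) auto
      ultimately have "(p1, d, p2) \<in> all_rwalks R \<times> ?D \<times> all_rwalks S"
        using rwalks_subset_all by blast
      then show ?thesis unfolding d(1) by (metis (mono_tags, lifting) UnI2 image_eqI case_prod_conv)
    qed
  qed
  then have "card (all_rwalks (R + S)) \<le>
      card (all_rwalks R \<union> ?f ` (all_rwalks R \<times> ?D \<times> all_rwalks S))"
    using finite_edges by (intro card_mono) auto
  also have "\<dots> \<le> card (all_rwalks R) + card (all_rwalks R \<times> ?D \<times> all_rwalks S)"
    using finite_edges by (intro order_trans[OF card_Un_le] add_mono card_image_le) auto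
  \<comment> \<open>The empty walk makes the count for \<open>S\<close> at least 1, so the lone
    summand may be multiplied by it.\<close>
  also have "\<dots> \<le> card (all_rwalks R) * card (all_rwalks S) +
      card (all_rwalks R) * (2 * card (edges G) * card (all_rwalks S))"
    using card_all_rwalks_ge_1[OF assms(1,3)]
    by (intro add_mono) (auto simp: card_cartesian_product)
  finally show ?thesis by (simp add: algebra_simps)
qed

text \<open>With \<open>F\<close> the edge set of a spanning tree, these walks are empty or end with
  a chord. Every reduced walk is one of them followed by a tree walk.\<close>

definition chord_walks :: "'e set \<Rightarrow> 'v \<Rightarrow> real \<Rightarrow> 'e dart list set" where
  "chord_walks F u R = {p \<in> rwalks u R. p = [] \<or> fst (last p) \<notin> F}"

lemma finite_chord_walks [simp]: "finite (chord_walks F u R)"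
  by (simp add: chord_walks_def)

section \<open>Counting relative to a set of tree edges\<close>

context
  fixes F :: "'e set" and b :: nat
  assumes acyclic: "\<And>u p. walk G u p u \<Longrightarrow> reduced p \<Longrightarrow> fst ` set p \<subseteq> F \<Longrightarrow> p = []"
    and card_chords: "card (edges G - F) = b"
begin

text \<open>Two different ones would give a nonempty reduced closed walk, whose edges still lie in
  \<open>F\<close> because reduction introduces no new dart.\<close>

lemma tree_walk_unique:
  assumes "walk G u p v" "walk G u q v" "reduced p" "reduced q"
    and "fst ` set p \<subseteq> F" "fst ` set q \<subseteq> F"
  shows "p = q"
proof (rule ccontr)
  assume "p \<noteq> q"
  with assms reduced_closed_walk_of_two obtain c where
    c: "walk G u c u" "reduced c" "c \<noteq> []" "c = reduce (p @ inv_walk q)" by metis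
  have "fst ` set c \<subseteq> fst ` set (p @ inv_walk q)" unfolding c(4) using set_reduce by (rule image_mono)
  also have "\<dots> \<subseteq> F" using assms by (simp add: image_Un)
  finally show False using acyclic c by blast
qed

lemma card_chord_darts: "card ((edges G - F) \<times> (UNIV :: bool set)) = 2 * b"
  by (simp add: card_cartesian_product card_chords)

text \<open>Removing the trailing tree walk leaves a chord walk. The removed part is determined by
  its ends, so a chord walk and a final vertex account for at most one walk.\<close>

lemma card_rwalks_le_chord_walks:
  "card (rwalks u R) \<le> card (chord_walks F u R) * card (verts G)"
proof -
  let ?T = "\<lambda>p v. {p @ q | q. \<exists>m. walk G u p m \<and> walk G m q v \<and> reduced q \<and> fst ` set q \<subseteq> F}"
  have T: "finite (?T p v) \<and> card (?T p v) \<le> 1" for p v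
  proof -
    have "x = y" if "x \<in> ?T p v" "y \<in> ?T p v" for x y
    proof -
      from that obtain q q' m m' where *: "x = p @ q" "y = p @ q'" "walk G u p m" "walk G u p m'"
        "walk G m q v" "walk G m' q' v" "reduced q" "reduced q'"
        "fst ` set q \<subseteq> F" "fst ` set q' \<subseteq> F" by blast
      then have "m' = m" by (metis walk_unique)
      with * show ?thesis by (auto intro: tree_walk_unique)
    qed
    then show ?thesis by (rule finite_card_le_1)
  qed
  have "rwalks u R \<subseteq> (\<Union>p\<in>chord_walks F u R. \<Union>v\<in>verts G. ?T p v)"
  proof
    fix p assume "p \<in> rwalks u R"
    then obtain v where p: "reduced p" "walk G u p v" "walk_length w p < R"
      by (auto simp: rwalks_def)
    obtain p1 q where q: "p = p1 @ q" "p1 = [] \<or> fst (last p1) \<notin> F" "fst ` set q \<subseteq> F"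
      using split_trailing[of p F] by blast
    obtain m where m: "walk G u p1 m" "walk G m q v" using p(2) unfolding q(1) walk_append by blast
    have "p1 \<in> chord_walks F u R"
      using p q m walk_length_walk_nonneg[OF m(2)]
      by (auto simp: chord_walks_def rwalks_def successively_append_iff)
    moreover have "p \<in> ?T p1 v" using p q m by (auto simp: successively_append_iff)
    moreover have "v \<in> verts G" using walk_end[OF m(2)] .
    ultimately show "p \<in> (\<Union>p\<in>chord_walks F u R. \<Union>v\<in>verts G. ?T p v)" by blast
  qed
  then have "card (rwalks u R) \<le> card (\<Union>p\<in>chord_walks F u R. \<Union>v\<in>verts G. ?T p v)"
    using T finite_verts by (intro card_mono finite_UN_I) auto
  also have "\<dots> \<le> (\<Sum>p\<in>chord_walks F u R. card (\<Union>v\<in>verts G. ?T p v))"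
    by (rule card_UN_le) simp
  also have "\<dots> \<le> (\<Sum>p\<in>chord_walks F u R. \<Sum>v\<in>verts G. card (?T p v))"
    by (intro sum_mono card_UN_le finite_verts)
  also have "\<dots> \<le> (\<Sum>p\<in>chord_walks F u R. \<Sum>v\<in>verts G. 1)"
    using T by (intro sum_mono) blast
  finally show ?thesis by simp
qed

context
  fixes s :: real
  assumes girth: "\<And>u p. walk G u p u \<Longrightarrow> reduced p \<Longrightarrow> p \<noteq> [] \<Longrightarrow> s \<le> walk_length w p"
    and s_pos: "0 < s"
begin

text \<open>Two distinct walks of length less than \<open>s / 2\<close> between the same vertices would create a
  short cycle, so such a walk is determined by its last dart.\<close>

lemma card_chord_walks_short: "card (chord_walks F u (s / 2)) \<le> 2 * b + 1"
proof -
  let ?D = "(edges G - F) \<times> (UNIV :: bool set)"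
  \<comment> \<open>The value \<open>None\<close> stands for the empty walk and is the source of the
    summand 1 in the bound.\<close>
  let ?f = "\<lambda>p. if p = [] then None else Some (last p)"
  have "inj_on ?f (chord_walks F u (s / 2))"
  proof (rule inj_onI, rule ccontr)
    fix p q assume p: "p \<in> chord_walks F u (s / 2)" and q: "q \<in> chord_walks F u (s / 2)"
      and eq: "?f p = ?f q" and ne: "p \<noteq> q"
    have ne': "p \<noteq> []" "q \<noteq> []" "last p = last q" using eq ne by (auto split: if_splits)
    obtain v v' where v: "walk G u p v" "walk G u q v'"
      using p q by (auto simp: chord_walks_def rwalks_def)
    have "v = v'" using walk_last[OF v(1)] walk_last[OF v(2)] ne' by simp
    with v have v: "walk G u p v" "walk G u q v" by simp_all
    have red: "reduced p" "reduced q" "walk_length w p < s / 2" "walk_length w q < s / 2"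
      using p q by (auto simp: chord_walks_def rwalks_def)
    obtain c where c: "walk G u c u" "reduced c" "c \<noteq> []" "c = reduce (p @ inv_walk q)"
      using reduced_closed_walk_of_two[OF v red(1,2) ne] by blast
    have "walk G u (p @ inv_walk q) u"
      using v(1) walk_inv_walk[OF v(2)] unfolding walk_append by blast
    then have "walk_length w c \<le> walk_length w (p @ inv_walk q)"
      unfolding c(4) by (rule walk_length_reduce_le)
    then show False using girth[OF c(1-3)] red by simp
  qed
  moreover have "?f ` chord_walks F u (s / 2) \<subseteq> insert None (Some ` ?D)"
  proof (rule image_subsetI)
    fix p assume "p \<in> chord_walks F u (s / 2)"
    then obtain v where p: "walk G u p v" "p = [] \<or> fst (last p) \<notin> F"
      by (auto simp: chord_walks_def rwalks_def)
    have "p \<noteq> [] \<Longrightarrow> last p \<in> ?D"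
      using walk_edges[OF p(1)] p(2) last_in_set[of p] by (auto simp: mem_Times_iff)
    then show "?f p \<in> insert None (Some ` ?D)" by simp
  qed
  ultimately have "card (chord_walks F u (s / 2)) \<le> card (insert None (Some ` ?D))"
    using finite_edges by (intro card_inj_on_le[of ?f]) auto
  also have "\<dots> \<le> Suc (card ?D)"
    using finite_edges by (simp add: card_insert_if card_image)
  finally show ?thesis using card_chord_darts by simp
qed

text \<open>A walk not shorter than \<open>s / 2\<close> is cut by \<open>split_greedy\<close> into
  \<open>p @ t @ f # q\<close>: at most \<open>2 * b + 1\<close> prefixes \<open>p\<close>,
  \<open>2 * b\<close> chord darts \<open>f\<close>, one tree walk \<open>t\<close> for given ends,
  and at most \<open>n\<close> remainders \<open>q\<close>. The bound \<open>n\<close> is uniform in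
  the vertex because \<open>q\<close> starts at the far end of \<open>f\<close>. The summand 1
  counts the walks shorter than \<open>s / 2\<close>.\<close>

lemma card_chord_walks_step:
  assumes "\<And>v. card (chord_walks F v R) \<le> n"
  shows "card (chord_walks F u (R + s / 2)) \<le> (2 * b + 1) * (1 + 2 * b * n)"
proof -
  let ?D = "(edges G - F) \<times> (UNIV :: bool set)"
  let ?end = "\<lambda>f. ends G (fst f) (\<not> snd f)"
  let ?T = "\<lambda>p f. {p @ t @ f # q | t q. \<exists>m. walk G u p m \<and> walk G m t (ends G (fst f) (snd f)) \<and>
    reduced t \<and> fst ` set t \<subseteq> F \<and> q \<in> chord_walks F (?end f) R}"
  have T: "finite (?T p f) \<and> card (?T p f) \<le> n" for p f
  proof (cases "?T p f = {}")
    case False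
    then obtain m t where t: "walk G u p m" "walk G m t (ends G (fst f) (snd f))" "reduced t"
      "fst ` set t \<subseteq> F" by blast
    \<comment> \<open>The members of \<open>?T p f\<close> differ only in \<open>q\<close>, since
      the tree walk from the end of \<open>p\<close> to \<open>f\<close> is unique.\<close>
    have "?T p f \<subseteq> (\<lambda>q. p @ t @ f # q) ` chord_walks F (?end f) R"
    proof (clarify)
      fix t' q m' assume *: "walk G u p m'" "walk G m' t' (ends G (fst f) (snd f))" "reduced t'"
        "fst ` set t' \<subseteq> F" "q \<in> chord_walks F (?end f) R"
      have "m' = m" using t(1) *(1) by (rule walk_unique[symmetric])
      with * t have "t' = t" by (intro tree_walk_unique[of m t' _ t]) auto
      with * show "p @ t' @ f # q \<in> (\<lambda>q. p @ t @ f # q) ` chord_walks F (?end f) R" by blast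
    qed
    then show ?thesis
      using assms[of "?end f"] by (meson finite_chord_walks finite_surj order_trans surj_card_le)
  next
    case True
    show ?thesis unfolding True by simp
  qed
  have "chord_walks F u (R + s / 2) \<subseteq>
      chord_walks F u (s / 2) \<union> (\<Union>p\<in>chord_walks F u (s / 2). \<Union>f\<in>?D. ?T p f)"
  proof
    fix p assume p: "p \<in> chord_walks F u (R + s / 2)"
    then obtain v where v: "walk G u p v" "reduced p" "walk_length w p < R + s / 2"
      and last: "p = [] \<or> fst (last p) \<notin> F" by (auto simp: chord_walks_def rwalks_def)
    show "p \<in> chord_walks F u (s / 2) \<union> (\<Union>p\<in>chord_walks F u (s / 2). \<Union>f\<in>?D. ?T p f)"
    proof (cases "walk_length w p < s / 2")
      case True
      then show ?thesis using p by (auto simp: chord_walks_def rwalks_def)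
    next
      case False
      have "\<exists>p1 t f q. [] @ p = p1 @ t @ f # q \<and> (p1 = [] \<or> fst (last p1) \<notin> F) \<and>
          walk_length w p1 < s / 2 \<and> fst ` set t \<subseteq> F \<and> fst f \<notin> F \<and>
          s / 2 \<le> walk_length w (p1 @ t @ [f]) \<and> (q = [] \<or> fst (last q) \<notin> F)"
        using False last s_pos by (intro split_greedy) auto
      then obtain p1 t f q where d: "p = p1 @ t @ f # q" "p1 = [] \<or> fst (last p1) \<notin> F"
        "walk_length w p1 < s / 2" "fst ` set t \<subseteq> F" "fst f \<notin> F"
        "s / 2 \<le> walk_length w (p1 @ t @ [f])" "q = [] \<or> fst (last q) \<notin> F"
        unfolding append_Nil by blast
      obtain m m' where m: "walk G u p1 m" "walk G m t m'" "walk G m' (f # q) v"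
        using v(1) unfolding d(1) walk_append by blast
      have red: "reduced p1" "reduced t" "reduced q"
        using v(2) unfolding d(1) by (auto simp: successively_append_iff successively_Cons)
      have f: "m' = ends G (fst f) (snd f)" "f \<in> ?D" "walk G (?end f) q v"
        using m(3) d(5) by (auto simp: walk_Cons mem_Times_iff)
      have "p1 \<in> chord_walks F u (s / 2)"
        using m(1) red(1) d(2,3) unfolding chord_walks_def rwalks_def by blast
      moreover have "walk_length w q < R" using v(3) d(6) unfolding d(1) by simp
      then have "q \<in> chord_walks F (?end f) R"
        using f(3) red(3) d(7) unfolding chord_walks_def rwalks_def by blast
      then have "p \<in> ?T p1 f" using m f(1) red(2) d(1,4) by blast
      ultimately show ?thesis using f(2) by blast
    qed
  qed
  then have "card (chord_walks F u (R + s / 2)) \<le>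
      card (chord_walks F u (s / 2) \<union> (\<Union>p\<in>chord_walks F u (s / 2). \<Union>f\<in>?D. ?T p f))"
    using T finite_edges by (intro card_mono finite_UnI finite_UN_I) auto
  also have "\<dots> \<le> card (chord_walks F u (s / 2)) +
      card (\<Union>p\<in>chord_walks F u (s / 2). \<Union>f\<in>?D. ?T p f)"
    by (rule card_Un_le)
  also have "card (\<Union>p\<in>chord_walks F u (s / 2). \<Union>f\<in>?D. ?T p f) \<le>
      (\<Sum>p\<in>chord_walks F u (s / 2). card (\<Union>f\<in>?D. ?T p f))"
    by (rule card_UN_le) simp
  also have "\<dots> \<le> (\<Sum>p\<in>chord_walks F u (s / 2). \<Sum>f\<in>?D. card (?T p f))"
    using finite_edges by (intro sum_mono card_UN_le) auto
  also have "\<dots> \<le> (\<Sum>p\<in>chord_walks F u (s / 2). \<Sum>f\<in>?D. n)"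
    using T by (intro sum_mono) blast
  also have "\<dots> = card (chord_walks F u (s / 2)) * (2 * b * n)"
    using card_chord_darts by simp
  finally have "card (chord_walks F u (R + s / 2)) \<le>
      card (chord_walks F u (s / 2)) * (1 + 2 * b * n)" by (simp add: algebra_simps)
  also have "\<dots> \<le> (2 * b + 1) * (1 + 2 * b * n)"
    using card_chord_walks_short by (intro mult_right_mono) auto
  finally show ?thesis .
qed

text \<open>The summand 1 on the left turns the affine recursion of
  \<open>card_chord_walks_step\<close> into a geometric one. It fits at \<open>k = 0\<close>, where
  no walk has negative length and the power is 1.\<close>

lemma card_chord_walks:
  assumes "1 \<le> b"
  shows "card (chord_walks F u (real k * (s / 2))) + 1 \<le> ((2 * b + 1) * (2 * b)) ^ k"
proof (induction k arbitrary: u)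
  case 0
  have "chord_walks F u 0 = {}"
    using walk_length_walk_nonneg by (fastforce simp: chord_walks_def rwalks_def)
  then show ?case by simp
next
  case (Suc k)
  let ?K = "(2 * b + 1) * (2 * b)"
  define n where "n = ?K ^ k - 1"
  have n: "n + 1 = ?K ^ k" using assms by (simp add: n_def)
  have "card (chord_walks F v (real k * (s / 2))) \<le> n" for v using Suc[of v] n by simp
  then have "card (chord_walks F u (real k * (s / 2) + s / 2)) \<le> (2 * b + 1) * (1 + 2 * b * n)"
    by (rule card_chord_walks_step)
  then have "card (chord_walks F u (real (Suc k) * (s / 2))) \<le> (2 * b + 1) * (1 + 2 * b * n)"
    by (simp add: distrib_right add.commute add_divide_distrib)
  \<comment> \<open>After expansion, the inequality needed is
    \<open>2 \<le> 4 * b * b\<close>.\<close>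
  moreover have "1 * 1 \<le> b * b" using assms by (intro mult_mono) auto
  then have "(2 * b + 1) * (1 + 2 * b * n) + 1 \<le> ?K * (n + 1)" by (simp add: algebra_simps)
  ultimately have "card (chord_walks F u (real (Suc k) * (s / 2))) + 1 \<le> ?K * (n + 1)" by linarith
  then show ?case unfolding n by simp
qed

text \<open>One factor \<open>card (verts G)\<close> is for the starting vertex, the other for the
  end of the trailing tree walk.\<close>

lemma card_all_rwalks_le:
  assumes "1 \<le> b"
  shows "card (all_rwalks (real k * (s / 2))) \<le> card (verts G) ^ 2 * ((2 * b + 1) * (2 * b)) ^ k"
proof -
  let ?K = "((2 * b + 1) * (2 * b)) ^ k"
  have "card (all_rwalks (real k * (s / 2))) \<le> (\<Sum>u\<in>verts G. card (rwalks u (real k * (s / 2))))"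
    unfolding all_rwalks_def by (intro card_UN_le finite_verts)
  also have "\<dots> \<le> (\<Sum>u\<in>verts G. ?K * card (verts G))"
  proof (rule sum_mono)
    fix u
    have "card (chord_walks F u (real k * (s / 2))) \<le> ?K" using card_chord_walks[OF assms, of u k] by simp
    then show "card (rwalks u (real k * (s / 2))) \<le> ?K * card (verts G)"
      using card_rwalks_le_chord_walks mult_right_mono by (meson order_trans zero_le)
  qed
  finally show ?thesis by (simp add: power2_eq_square algebra_simps)
qed

end

end

end

section \<open>The universal cover\<close>

lemma verts_universal_cover:
  "verts (universal_cover G v) = {homotopy_class G v p | p u. walk G v p u}"
  and edges_universal_cover: "edges (universal_cover G v) =
    {(homotopy_class G v p, e) | p e. e \<in> edges G \<and> walk G v p (ends G e False)}"
  and ends_universal_cover_False: "ends (universal_cover G v) f False = fst f"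
  by (simp_all add: universal_cover_def case_prod_unfold)

lemma lifted_weight_apply: "lifted_weight w f = w (snd f)"
  by (simp add: lifted_weight_def)

lemma homotopy_class_endpoint:
  assumes "walk G v p u" "walk G v q u'" "homotopy_class G v p = homotopy_class G v q"
  shows "u = u'"
proof -
  have "reduce p = reduce q" using assms homotopy_class_eq_iff by metis
  then show ?thesis using walk_reduce[OF assms(1)] walk_reduce[OF assms(2)] walk_unique by metis
qed

lemma homotopy_class_append:
  assumes "walk G v p u" "walk G v q u'" "homotopy_class G v p = homotopy_class G v q"
    and "walk G u r z"
  shows "homotopy_class G v (p @ r) = homotopy_class G v (q @ r)"
proof -
  have u: "u' = u" using homotopy_class_endpoint[OF assms(1-3)] by (rule HOL.sym)
  have "reduce p = reduce q" using assms homotopy_class_eq_iff by metis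
  then have r: "reduce (p @ r) = reduce (q @ r)" by (rule reduce_append_cong) (rule HOL.refl)
  have "walk G v (p @ r) z" "walk G v (q @ r) z"
    using walk_appendI[OF assms(1,4)] walk_appendI[OF assms(2)] assms(4) u by simp_all
  from homotopy_class_eq_iff[OF this] r show ?thesis by simp
qed

lemma homotopy_class_backtrack:
  assumes "walk G v p u" "walk G u [d] z"
  shows "homotopy_class G v (p @ [d, rev_dart d]) = homotopy_class G v p"
proof -
  have "walk G u [d, rev_dart d] u"
    using assms(2) by (auto simp: walk_Cons rev_dart_def)
  then have "walk G v (p @ [d, rev_dart d]) u" using assms(1) unfolding walk_append by blast
  then show ?thesis using reduce_backtrack[of p d "[]"] assms(1) homotopy_class_eq_iff by fastforce
qed

text \<open>All representatives of the class have the same prolonged class, so the union in the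
  definition of the cover is a union of equal sets.\<close>

lemma ends_universal_cover_True:
  assumes "walk G v p u" "walk G u [(e, False)] z"
  shows "ends (universal_cover G v) (homotopy_class G v p, e) True =
    homotopy_class G v (p @ [(e, False)])"
proof -
  have "homotopy_class G v (q @ [(e, False)]) = homotopy_class G v (p @ [(e, False)])"
    if "q \<in> homotopy_class G v p" for q
  proof -
    from that have q: "walk G v q u" "reduce p = reduce q"
      unfolding homotopy_class_eq[OF assms(1)] by auto
    then have "homotopy_class G v q = homotopy_class G v p"
      using assms(1) homotopy_class_eq_iff by metis
    then show ?thesis using homotopy_class_append[OF q(1) assms(1)] assms(2) by blast
  qed
  moreover have "p \<in> homotopy_class G v p"
    unfolding homotopy_class_eq[OF assms(1)] using assms(1) by simp
  ultimately have "(\<Union>q\<in>homotopy_class G v p. homotopy_class G v (q @ [(e, False)])) =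
    homotopy_class G v (p @ [(e, False)])" by blast
  then show ?thesis by (simp add: universal_cover_def)
qed

lemma universal_cover_dart:
  assumes "walk G v p u" "walk G u [(e, a)] z"
  shows "\<exists>f\<in>edges (universal_cover G v). snd f = e \<and>
    ends (universal_cover G v) f a = homotopy_class G v p \<and>
    ends (universal_cover G v) f (\<not> a) = homotopy_class G v (p @ [(e, a)])"
proof (cases a)
  case False
  have e: "walk G u [(e, False)] z" using assms(2) False by auto
  have "u = ends G e False" "e \<in> edges G" using assms(2) False by auto
  then have "(homotopy_class G v p, e) \<in> edges (universal_cover G v)"
    using assms(1) by (auto simp: edges_universal_cover)
  then show ?thesis
    using False ends_universal_cover_True[OF assms(1) e]
    by (intro bexI[of _ "(homotopy_class G v p, e)"]) (simp_all add: ends_universal_cover_False)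
next
  case True
  \<comment> \<open>An edge of the cover is named after the class at its end \<open>False\<close>,
    which for this direction is the far end of the dart.\<close>
  let ?p = "p @ [(e, True)]"
  have u: "u = ends G e True" "z = ends G e False" "e \<in> edges G" "u \<in> verts G"
    using assms(2) True by auto
  have p: "walk G v ?p z" using walk_appendI[OF assms] True by simp
  have rd: "rev_dart (e, True) = (e, False)" by (simp add: rev_dart_def)
  have f: "(homotopy_class G v ?p, e) \<in> edges (universal_cover G v)"
    using p u by (auto simp: edges_universal_cover)
  have "walk G z [(e, False)] u" using u walk_end[OF p] by simp
  from ends_universal_cover_True[OF p this]
  have "ends (universal_cover G v) (homotopy_class G v ?p, e) True = homotopy_class G v p"
    using homotopy_class_backtrack[OF assms(1) assms(2)] True rd by simp
  then show ?thesis using f True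
    by (intro bexI[of _ "(homotopy_class G v ?p, e)"]) (simp_all add: ends_universal_cover_False)
qed

text \<open>Converse of \<open>universal_cover_dart\<close>. The edge is named after some
  representative \<open>q\<close>, and the proof passes from \<open>q\<close> to the given walk
  \<open>p\<close>.\<close>

lemma universal_cover_edge:
  assumes "f \<in> edges (universal_cover G v)" "walk G v p u"
    and "ends (universal_cover G v) f a = homotopy_class G v p"
    and "ends G (snd f) True \<in> verts G"
  shows "walk G u [(snd f, a)] (ends G (snd f) (\<not> a)) \<and>
    ends (universal_cover G v) f (\<not> a) = homotopy_class G v (p @ [(snd f, a)])"
proof -
  obtain q e where f: "f = (homotopy_class G v q, e)" and e: "e \<in> edges G"
    and q: "walk G v q (ends G e False)" using assms(1) by (auto simp: edges_universal_cover)
  have e': "walk G (ends G e False) [(e, False)] (ends G e True)"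
    using e assms(4) walk_end[OF q] f by simp
  note T = ends_universal_cover_True[OF q e', folded f]
  show ?thesis
  proof (cases a)
    case False
    then have c: "homotopy_class G v q = homotopy_class G v p"
      using assms(3) f by (simp add: ends_universal_cover_False)
    have "u = ends G e False"
      using homotopy_class_endpoint[OF q assms(2) c] by simp
    then show ?thesis using False e' f T homotopy_class_append[OF q assms(2) c e'] by simp
  next
    case True
    let ?q = "q @ [(e, False)]"
    have q': "walk G v ?q (ends G e True)" using q e' unfolding walk_append by blast
    have c: "homotopy_class G v ?q = homotopy_class G v p" using assms(3) T True by simp
    have u: "u = ends G e True" using homotopy_class_endpoint[OF q' assms(2) c] by simp
    have e'': "walk G (ends G e True) [(e, True)] (ends G e False)"
      using e walk_end[OF q'] walk_end[OF q] by simp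
    have "homotopy_class G v (p @ [(e, True)]) = homotopy_class G v (?q @ [(e, True)])"
      using homotopy_class_append[OF q' assms(2) c e''] by simp
    also have "\<dots> = homotopy_class G v q"
      using homotopy_class_backtrack[OF q e'] by (simp add: rev_dart_def)
    finally show ?thesis using True u e'' f by (simp add: ends_universal_cover_False)
  qed
qed

lemma universal_cover_lift_walk:
  "walk G v p u \<Longrightarrow> \<exists>P. walk (universal_cover G v) (homotopy_class G v []) P (homotopy_class G v p) \<and>
    walk_length (lifted_weight w) P = walk_length w p"
proof (induction p arbitrary: u rule: rev_induct)
  case Nil
  then have "homotopy_class G v [] \<in> verts (universal_cover G v)"
    unfolding verts_universal_cover by blast
  then show ?case by (intro exI[of _ "[]"]) simp
next
  case (snoc d p)
  let ?H = "universal_cover G v"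
  obtain m where m: "walk G v p m" "walk G m [d] u" using snoc.prems unfolding walk_append by blast
  obtain P where P: "walk ?H (homotopy_class G v []) P (homotopy_class G v p)"
    "walk_length (lifted_weight w) P = walk_length w p" using snoc.IH[OF m(1)] by blast
  obtain e a where d: "d = (e, a)" by (cases d)
  obtain f where f: "f \<in> edges ?H" "snd f = e" "ends ?H f a = homotopy_class G v p"
    "ends ?H f (\<not> a) = homotopy_class G v (p @ [d])"
    using universal_cover_dart[OF m(1) m(2)[unfolded d]] unfolding d by blast
  have "homotopy_class G v (p @ [d]) \<in> verts ?H" using snoc.prems unfolding verts_universal_cover by blast
  then have "walk ?H (homotopy_class G v p) [(f, a)] (homotopy_class G v (p @ [d]))"
    using f walk_end[OF P(1)] by simp
  with P f show ?case unfolding d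
    by (intro exI[of _ "P @ [(f, a)]"]) (auto simp: walk_append lifted_weight_apply[of w f])
qed

context weighted_multigraph
begin

lemma universal_cover_edge_snd: "f \<in> edges (universal_cover G v) \<Longrightarrow> snd f \<in> edges G"
  by (auto simp: edges_universal_cover)

text \<open>The walk may start at the class of any \<open>p1\<close>, so that the induction can
  absorb the darts of \<open>P\<close> into \<open>p1\<close> one after the other.\<close>

lemma universal_cover_project_walk:
  "walk (universal_cover G v) c1 P c2 \<Longrightarrow> walk G v p1 u1 \<Longrightarrow> c1 = homotopy_class G v p1 \<Longrightarrow>
    \<exists>p u2. walk G v (p1 @ p) u2 \<and> c2 = homotopy_class G v (p1 @ p) \<and>
      walk_length w p = walk_length (lifted_weight w) P"
proof (induction P arbitrary: c1 p1 u1)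
  case Nil
  then show ?case by (intro exI[of _ "[]"]) auto
next
  case (Cons D P)
  let ?H = "universal_cover G v"
  obtain f a where D: "D = (f, a)" by (cases D)
  have f: "f \<in> edges ?H" "ends ?H f a = homotopy_class G v p1"
    and P: "walk ?H (ends ?H f (\<not> a)) P c2" using Cons.prems D by simp_all
  have "ends G (snd f) True \<in> verts G" using ends_in_verts universal_cover_edge_snd[OF f(1)] by blast
  from universal_cover_edge[OF f(1) Cons.prems(2) f(2) this]
  have e: "walk G v (p1 @ [(snd f, a)]) (ends G (snd f) (\<not> a))"
    "ends ?H f (\<not> a) = homotopy_class G v (p1 @ [(snd f, a)])"
    using Cons.prems(2) unfolding walk_append by blast+
  from Cons.IH[OF P e] obtain p u2 where "walk G v ((p1 @ [(snd f, a)]) @ p) u2"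
    "c2 = homotopy_class G v ((p1 @ [(snd f, a)]) @ p)"
    "walk_length w p = walk_length (lifted_weight w) P" by blast
  then show ?case unfolding D
    by (intro exI[of _ "(snd f, a) # p"] exI[of _ u2]) (simp add: lifted_weight_apply[of w f])
qed

lemma walk_length_universal_cover_nonneg:
  assumes "walk (universal_cover G v) c P c'" shows "0 \<le> walk_length (lifted_weight w) P"
proof (rule walk_length_nonneg)
  fix D assume "D \<in> set P"
  then have "fst D \<in> edges (universal_cover G v)" using walk_edges[OF assms] by auto
  then show "0 \<le> lifted_weight w (fst D)"
    using weight_pos[OF universal_cover_edge_snd] by (simp add: lifted_weight_apply less_imp_le)
qed

lemma reduced_in_rwalks:
  assumes "walk G v p u" "walk_length w p < R" shows "reduce p \<in> rwalks v R"
  using assms walk_reduce[OF assms(1)] walk_length_reduce_le[OF assms(1)]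
  unfolding rwalks_def by auto

lemma homotopy_class_reduce:
  assumes "walk G v p u" shows "homotopy_class G v (reduce p) = homotopy_class G v p"
  using homotopy_class_eq_iff[OF walk_reduce[OF assms] assms] by (simp add: reduce_reduced)

section \<open>Volume of balls in the universal cover\<close>

context
  fixes e0 :: 'e and t0 W :: real
  assumes e0: "e0 \<in> edges G" and t0: "0 \<le> t0" "t0 \<le> w e0"
    and W: "0 < W" "\<And>e. e \<in> edges G \<Longrightarrow> w e \<le> W"
begin

private abbreviation (input) "v0 \<equiv> ends G e0 False"
private abbreviation (input) "cls \<equiv> homotopy_class G (ends G e0 False)"
private abbreviation (input) "H \<equiv> universal_cover G (ends G e0 False)"
private abbreviation (input) "lw \<equiv> lifted_weight w"
private abbreviation (input) "x0 \<equiv> ((homotopy_class G (ends G e0 False) [], e0), t0)"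
private abbreviation (input) "cover_ball \<equiv> graph_ball (universal_cover G (ends G e0 False)) (lifted_weight w)
  ((homotopy_class G (ends G e0 False) [], e0), t0)"

lemma walk_Nil_base: "walk G v0 [] v0"
  using ends_in_verts[OF e0] by simp

lemma walk_e0: "walk G v0 [(e0, False)] (ends G e0 True)"
  using ends_in_verts[OF e0] e0 by simp

lemma path_lengths_nonneg:
  assumes "y \<in> points H lw" "l \<in> path_lengths H lw x0 y" shows "0 \<le> l"
proof -
  have "0 \<le> dist_to_end lw x0 a" "0 \<le> dist_to_end lw y a" for a
    using assms(1) t0 by (auto simp: dist_to_end_def points_def lifted_weight_apply)
  moreover note walk_length_universal_cover_nonneg
  ultimately have "0 \<le> dist_to_end lw x0 a + walk_length lw p + dist_to_end lw y a'"
    if "walk H (ends H (fst x0) a) p (ends H (fst y) a')" for a p a'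
    using that by (meson add_nonneg_nonneg)
  then show ?thesis using assms(2) unfolding path_lengths_def by (auto split: if_splits)
qed

lemma point_dist_le:
  assumes "y \<in> points H lw" "l \<in> path_lengths H lw x0 y" shows "point_dist H lw x0 y \<le> l"
  unfolding point_dist_def using path_lengths_nonneg[OF assms(1)] assms(2)
  by (intro cInf_lower) (auto simp: bdd_below_def)

text \<open>An infimum below \<open>R\<close> yields an element below \<open>R\<close> because the
  set is nonempty: lifting \<open>q\<close> joins the base class to an end of
  \<open>f\<close>.\<close>

lemma point_dist_lessD:
  assumes "(f, t) \<in> points H lw" "point_dist H lw x0 (f, t) < R"
  shows "\<exists>l\<in>path_lengths H lw x0 (f, t). l < R"
proof (rule cInf_lessD)
  obtain q e where f: "f = (cls q, e)" "walk G v0 q (ends G e False)"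
    using assms(1) by (auto simp: points_def edges_universal_cover)
  obtain P where "walk H (cls []) P (cls q)" using universal_cover_lift_walk[OF f(2)] by blast
  then have "walk H (ends H (fst x0) False) P (ends H (fst (f, t)) False)"
    using f by (simp add: ends_universal_cover_False)
  then show "path_lengths H lw x0 (f, t) \<noteq> {}" unfolding path_lengths_def by blast
qed (use assms in \<open>simp add: point_dist_def\<close>)

text \<open>A path shorter than \<open>R\<close> from the base point to a point of \<open>f\<close>
  projects to a walk of \<open>G\<close>. At most one edge is added at each end to obtain a walk
  from \<open>v0\<close> whose class is the end \<open>False\<close> of \<open>f\<close>, hence the
  margin \<open>2 * W\<close>.\<close>

lemma ball_edges:
  assumes "(f, t) \<in> cover_ball R" "0 < R"
  shows "f \<in> (\<lambda>(p, e). (cls p, e)) ` (rwalks v0 (R + 2 * W) \<times> edges G)"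
proof -
  have y: "(f, t) \<in> points H lw" and d: "point_dist H lw x0 (f, t) < R"
    using assms by (auto simp: graph_ball_def)
  obtain q e where f: "f = (cls q, e)" "walk G v0 q (ends G e False)" and e: "e \<in> edges G"
    using y by (auto simp: points_def edges_universal_cover)
  have fH: "f \<in> edges H" using y by (simp add: points_def)
  have "\<exists>p u. walk G v0 p u \<and> walk_length w p < R + 2 * W \<and> cls p = cls q"
  proof -
    obtain l where l: "l \<in> path_lengths H lw x0 (f, t)" "l < R"
      using point_dist_lessD[OF y d] by blast
    show ?thesis
    proof (cases "fst x0 = f \<and> l = \<bar>t0 - t\<bar>")
      case True
      then show ?thesis using walk_Nil_base W assms(2) f by (intro exI[of _ "[]"] exI[of _ v0]) auto
    next
      case False
      then obtain a P a' where P: "walk H (ends H (cls [], e0) a) P (ends H f a')"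
        and "l = dist_to_end lw x0 a + walk_length lw P + dist_to_end lw (f, t) a'"
        using l(1) unfolding path_lengths_def by (auto split: if_splits)
      moreover have "0 \<le> dist_to_end lw x0 a" "0 \<le> dist_to_end lw (f, t) a'"
        using y t0 by (auto simp: dist_to_end_def points_def lifted_weight_apply)
      ultimately have P_len: "walk_length lw P < R" using l(2) by linarith
      \<comment> \<open>If the path leaves \<open>e0\<close> through its end \<open>True\<close>,
        the walk from \<open>v0\<close> must cross \<open>e0\<close> first.\<close>
      define q0 where "q0 = (if a then [(e0, False)] else [])"
      have q0: "walk G v0 q0 (ends G e0 a)" "walk_length w q0 \<le> W"
        using walk_Nil_base walk_e0 W e0 by (auto simp: q0_def)
      have "ends H (cls [], e0) a = cls q0"
        using ends_universal_cover_True[OF walk_Nil_base walk_e0]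
        by (cases a) (simp_all add: q0_def ends_universal_cover_False)
      from universal_cover_project_walk[OF P q0(1) this] obtain p u where
        p: "walk G v0 (q0 @ p) u" "ends H f a' = cls (q0 @ p)" "walk_length w p = walk_length lw P"
        by blast
      show ?thesis
      proof (cases a')
        case False
        have "walk_length w (q0 @ p) < R + 2 * W" using q0(2) p(3) P_len W by simp
        moreover have "cls (q0 @ p) = cls q"
          using p(2) False f by (simp add: ends_universal_cover_False)
        ultimately show ?thesis using p(1) by blast
      next
        \<comment> \<open>The path enters \<open>f\<close> through its end \<open>True\<close>;
          crossing \<open>e\<close> backwards leads to the class that names
          \<open>f\<close>.\<close>
        case True
        have "ends G (snd f) True \<in> verts G" using f e ends_in_verts by simp
        from universal_cover_edge[OF fH p(1,2) this]
        have *: "walk G u [(e, True)] (ends G e False)" "cls q = cls ((q0 @ p) @ [(e, True)])"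
          using True f by (simp_all add: ends_universal_cover_False del: walk.simps)
        have "walk G v0 ((q0 @ p) @ [(e, True)]) (ends G e False)"
          using p(1) *(1) unfolding walk_append by blast
        moreover have "walk_length w ((q0 @ p) @ [(e, True)]) < R + 2 * W"
          using q0(2) p(3) P_len W(2)[OF e] by simp
        ultimately show ?thesis using *(2) by metis
      qed
    qed
  qed
  then obtain p u where p: "walk G v0 p u" "walk_length w p < R + 2 * W" "cls p = cls q" by blast
  show ?thesis
  proof (rule image_eqI)
    show "f = (\<lambda>(p, e). (cls p, e)) (reduce p, e)"
      using homotopy_class_reduce[OF p(1)] p(3) f by simp
    show "(reduce p, e) \<in> rwalks v0 (R + 2 * W) \<times> edges G"
      using reduced_in_rwalks[OF p(1,2)] e by simp
  qed
qed

lemma slice_measure_le: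
  assumes "f \<in> edges H"
  shows "measure lborel {t. (f, t) \<in> cover_ball R} \<le> w (snd f)"
proof -
  have "0 \<le> w (snd f)" using weight_pos[OF universal_cover_edge_snd[OF assms]] by simp
  have "{t. (f, t) \<in> cover_ball R} \<subseteq> {0..w (snd f)}"
    by (auto simp: graph_ball_def points_def lifted_weight_apply)
  then have "emeasure lborel {t. (f, t) \<in> cover_ball R} \<le> emeasure lborel {0..w (snd f)}"
    by (intro emeasure_mono) auto
  also have "\<dots> = ennreal (w (snd f))" using \<open>0 \<le> w (snd f)\<close> by simp
  finally show ?thesis using \<open>0 \<le> w (snd f)\<close> by (simp add: measure_def enn2real_leI)
qed

lemma finite_ball_edges:
  assumes "0 < R"
  shows "finite {f \<in> edges H. \<exists>t. (f, t) \<in> cover_ball R}"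
    "card {f \<in> edges H. \<exists>t. (f, t) \<in> cover_ball R} \<le> card (rwalks v0 (R + 2 * W)) * card (edges G)"
proof -
  let ?I = "(\<lambda>(p, e). (cls p, e)) ` (rwalks v0 (R + 2 * W) \<times> edges G)"
  have sub: "{f \<in> edges H. \<exists>t. (f, t) \<in> cover_ball R} \<subseteq> ?I" using ball_edges assms by blast
  have fin: "finite (rwalks v0 (R + 2 * W) \<times> edges G)" using finite_edges by simp
  then show "finite {f \<in> edges H. \<exists>t. (f, t) \<in> cover_ball R}" using sub finite_subset by blast
  have "card {f \<in> edges H. \<exists>t. (f, t) \<in> cover_ball R} \<le> card ?I" using sub fin by (intro card_mono) auto
  also have "\<dots> \<le> card (rwalks v0 (R + 2 * W) \<times> edges G)" using fin by (rule card_image_le)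
  finally show "card {f \<in> edges H. \<exists>t. (f, t) \<in> cover_ball R} \<le>
    card (rwalks v0 (R + 2 * W)) * card (edges G)" by (simp add: card_cartesian_product)
qed

text \<open>Only finitely many edges of the cover meet the ball; the other summands vanish.\<close>

lemma graph_volume_ball:
  assumes "0 < R"
  shows "graph_volume H (cover_ball R) =
    (\<Sum>f | f \<in> edges H \<and> (\<exists>t. (f, t) \<in> cover_ball R). measure lborel {t. (f, t) \<in> cover_ball R})"
proof -
  have "graph_volume H (cover_ball R) = (\<Sum>\<^sub>\<infinity>f\<in>{f \<in> edges H. \<exists>t. (f, t) \<in> cover_ball R}.
      measure lborel {t. (f, t) \<in> cover_ball R})"
    unfolding graph_volume_def by (rule infsum_cong_neutral) auto
  then show ?thesis using finite_ball_edges(1)[OF assms] by simp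
qed

lemma graph_volume_ball_le:
  assumes "0 < R"
  shows "graph_volume H (cover_ball R) \<le> W * card (edges G) * card (all_rwalks (R + 2 * W))"
proof -
  have "graph_volume H (cover_ball R) \<le> (\<Sum>f | f \<in> edges H \<and> (\<exists>t. (f, t) \<in> cover_ball R). W)"
    unfolding graph_volume_ball[OF assms]
  proof (rule sum_mono)
    fix f assume "f \<in> {f. f \<in> edges H \<and> (\<exists>t. (f, t) \<in> cover_ball R)}"
    then have f: "f \<in> edges H" by simp
    show "measure lborel {t. (f, t) \<in> cover_ball R} \<le> W"
      using slice_measure_le[OF f] W(2)[OF universal_cover_edge_snd[OF f]] by (rule order_trans)
  qed
  also have "\<dots> = real (card {f \<in> edges H. \<exists>t. (f, t) \<in> cover_ball R}) * W" by simp
  also have "\<dots> \<le> real (card (rwalks v0 (R + 2 * W)) * card (edges G)) * W"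
    using finite_ball_edges(2)[OF assms] W(1) by (intro mult_right_mono) (simp_all only: of_nat_le_iff less_imp_le)
  also have "\<dots> \<le> real (card (all_rwalks (R + 2 * W)) * card (edges G)) * W"
    using card_mono[OF finite_all_rwalks rwalks_subset_all, of v0 "R + 2 * W"] W(1)
    by (intro mult_right_mono) (simp_all only: of_nat_le_iff less_imp_le mult_le_mono1)
  finally show ?thesis by (simp add: algebra_simps)
qed

text \<open>The last edge of the lift of \<open>p\<close> lies wholly in the ball: reaching any of
  its points costs at most \<open>W\<close> on \<open>e0\<close>, the length of \<open>p\<close>,
  and at most \<open>W\<close> on the edge itself.\<close>

lemma ball_contains_edge:
  assumes "p \<in> rwalks v0 (R - 2 * W)" "p \<noteq> []"
  shows "\<exists>f\<in>edges H. snd f = fst (last p) \<and> ends H f (snd (last p)) = cls (butlast p) \<and>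
    ends H f (\<not> snd (last p)) = cls p \<and> {t. (f, t) \<in> cover_ball R} = {0..w (snd f)}"
proof -
  obtain u where p: "reduced p" "walk G v0 p u" "walk_length w p < R - 2 * W"
    using assms(1) by (auto simp: rwalks_def)
  obtain e a where d: "last p = (e, a)" by (cases "last p")
  then have pd: "p = butlast p @ [(e, a)]" using append_butlast_last_id[OF assms(2)] by simp
  have "walk G v0 (butlast p @ [(e, a)]) u" using p(2) pd by simp
  then obtain m where m: "walk G v0 (butlast p) m" "walk G m [(e, a)] u"
    unfolding walk_append by blast
  obtain f where f: "f \<in> edges H" "snd f = e" "ends H f a = cls (butlast p)"
    "ends H f (\<not> a) = cls p"
    using universal_cover_dart[OF m] unfolding pd[symmetric] by blast
  have e: "e \<in> edges G" using m(2) by simp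
  obtain P where P: "walk H (cls []) P (cls p)" "walk_length lw P = walk_length w p"
    using universal_cover_lift_walk[OF p(2)] by blast
  have "(f, t) \<in> cover_ball R" if t: "0 \<le> t" "t \<le> w e" for t
  proof -
    have y: "(f, t) \<in> points H lw" using f t by (simp add: points_def lifted_weight_apply)
    \<comment> \<open>The path goes back along \<open>e0\<close> to the base class, follows the lift
      of \<open>p\<close>, and enters \<open>f\<close> through the end at which \<open>p\<close>
      arrives.\<close>
    let ?l = "dist_to_end lw x0 False + walk_length lw P + dist_to_end lw (f, t) (\<not> a)"
    have "walk H (ends H (fst x0) False) P (ends H (fst (f, t)) (\<not> a))"
      using P(1) f(4) by (simp add: ends_universal_cover_False)
    then have "?l \<in> path_lengths H lw x0 (f, t)" unfolding path_lengths_def by blast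
    then have "point_dist H lw x0 (f, t) \<le> ?l" by (rule point_dist_le[OF y])
    moreover have "dist_to_end lw x0 False \<le> W" "dist_to_end lw (f, t) (\<not> a) \<le> W"
      using t t0 W(2)[OF e0] W(2)[OF e] f by (auto simp: dist_to_end_def lifted_weight_apply)
    ultimately have "point_dist H lw x0 (f, t) < R" using P(2) p(3) by linarith
    then show ?thesis using y by (simp add: graph_ball_def)
  qed
  moreover have "0 \<le> t \<and> t \<le> w e" if "(f, t) \<in> cover_ball R" for t
    using that f by (simp add: graph_ball_def points_def lifted_weight_apply)
  ultimately have "(f, t) \<in> cover_ball R \<longleftrightarrow> t \<in> {0..w e}" for t unfolding atLeastAtMost_iff by blast
  then have "{t. (f, t) \<in> cover_ball R} = {0..w e}" by (simp only: Collect_mem_eq)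
  then show ?thesis using f d by auto
qed

text \<open>Different nonempty reduced walks from \<open>v0\<close> have different last edges in the
  cover, and each of these edges contributes at least \<open>m\<close>. The factor 2 makes up for
  the empty walk, which has no last edge.\<close>

lemma graph_volume_ball_ge:
  assumes m: "0 < m" "\<And>e. e \<in> edges G \<Longrightarrow> m \<le> w e" and R: "3 * W < R"
  shows "m * card (rwalks v0 (R - 2 * W)) \<le> 2 * graph_volume H (cover_ball R)"
proof -
  let ?A = "rwalks v0 (R - 2 * W) - {[]}"
  have "0 < R" using R W by simp
  have "\<forall>p\<in>?A. \<exists>f. f \<in> edges H \<and> snd f = fst (last p) \<and>
      ends H f (snd (last p)) = cls (butlast p) \<and>
      ends H f (\<not> snd (last p)) = cls p \<and> {t. (f, t) \<in> cover_ball R} = {0..w (snd f)}"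
    using ball_contains_edge by blast
  from bchoice[OF this] obtain g where g: "\<And>p. p \<in> ?A \<Longrightarrow> g p \<in> edges H"
    "\<And>p. p \<in> ?A \<Longrightarrow> snd (g p) = fst (last p)"
    "\<And>p. p \<in> ?A \<Longrightarrow> ends H (g p) (snd (last p)) = cls (butlast p)"
    "\<And>p. p \<in> ?A \<Longrightarrow> ends H (g p) (\<not> snd (last p)) = cls p"
    "\<And>p. p \<in> ?A \<Longrightarrow> {t. (g p, t) \<in> cover_ball R} = {0..w (snd (g p))}" by blast
  have A: "reduced p" "p = butlast p @ [last p]" "reduced (butlast p)"
    "\<exists>u. walk G v0 p u" "\<exists>u. walk G v0 (butlast p) u" if "p \<in> ?A" for p
  proof -
    show p: "p = butlast p @ [last p]" using that by simp
    show "reduced p" "\<exists>u. walk G v0 p u" using that by (auto simp: rwalks_def)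
    then have "reduced (butlast p @ [last p])" "\<exists>u. walk G v0 (butlast p @ [last p]) u"
      using p by simp_all
    then show "reduced (butlast p)" "\<exists>u. walk G v0 (butlast p) u"
      unfolding walk_append successively_append_iff by blast+
  qed
  have cls_inj: "p = q" if "reduced p" "reduced q" "\<exists>u. walk G v0 p u" "\<exists>u. walk G v0 q u"
    "cls p = cls q" for p q
    using that homotopy_class_eq_iff reduce_reduced by metis
  have "inj_on g ?A"
  proof (rule inj_onI)
    fix p q assume p: "p \<in> ?A" and q: "q \<in> ?A" and eq: "g p = g q"
    have fst: "fst (last p) = fst (last q)" using g(2)[OF p] g(2)[OF q] eq by simp
    show "p = q"
    proof (cases "snd (last p) = snd (last q)")
      case True
      then have "cls p = cls q" using g(4)[OF p] g(4)[OF q] eq by simp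
      then show ?thesis using cls_inj A(1,4)[OF p] A(1,4)[OF q] by blast
    next
      \<comment> \<open>If the common edge were crossed in opposite directions, \<open>p\<close>
        would be \<open>q\<close> followed by a backtrack.\<close>
      case False
      then have "cls (butlast p) = cls q" using g(3)[OF p] g(4)[OF q] eq by simp
      then have "butlast p = q" using cls_inj A(3,5)[OF p] A(1,4)[OF q] by blast
      moreover have "last p = rev_dart (last q)"
        using fst False by (auto simp: rev_dart_def prod_eq_iff)
      ultimately have "p = butlast q @ [last q, rev_dart (last q)]"
        using A(2)[OF p] A(2)[OF q] by (metis append.assoc append_Cons append_Nil)
      then have "\<not> reduced p" by (simp add: successively_append_iff)
      then show ?thesis using A(1)[OF p] by blast
    qed
  qed
  then have card: "card (g ` ?A) = card ?A" by (rule card_image)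
  have "0 < w e0" using weight_pos[OF e0] .
  \<comment> \<open>From \<open>3 * W < R\<close> the walk along \<open>e0\<close> alone is short
    enough, so \<open>?A\<close> is nonempty and adding the empty walk at most doubles the
    count.\<close>
  have "[(e0, False)] \<in> ?A" "[] \<in> rwalks v0 (R - 2 * W)"
    using walk_e0 walk_Nil_base W(1) W(2)[OF e0] R by (auto simp: rwalks_def simp del: walk.simps)
  then have "0 < card ?A" "card (rwalks v0 (R - 2 * W)) = card ?A + 1"
    using card_Suc_Diff1[OF finite_rwalks] finite_Diff[OF finite_rwalks]
    unfolding card_gt_0_iff by fastforce+
  then have "real (card (rwalks v0 (R - 2 * W))) \<le> 2 * real (card ?A)" by linarith
  then have "m * card (rwalks v0 (R - 2 * W)) \<le> 2 * (\<Sum>f\<in>g ` ?A. m)"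
    using m(1) card by (simp add: mult_left_mono algebra_simps)
  also have "(\<Sum>f\<in>g ` ?A. m) \<le> (\<Sum>f\<in>g ` ?A. measure lborel {t. (f, t) \<in> cover_ball R})"
  proof (rule sum_mono)
    fix f assume "f \<in> g ` ?A"
    then obtain p where p: "f = g p" "p \<in> ?A" by blast
    have "m \<le> w (snd f)" using m(2) universal_cover_edge_snd g(1) p by blast
    then show "m \<le> measure lborel {t. (f, t) \<in> cover_ball R}" using g(5)[OF p(2)] m(1) p(1) by simp
  qed
  also have "\<dots> \<le> graph_volume H (cover_ball R)"
    unfolding graph_volume_ball[OF \<open>0 < R\<close>]
  proof (rule sum_mono2[OF finite_ball_edges(1)[OF \<open>0 < R\<close>]])
    show "g ` ?A \<subseteq> {f. f \<in> edges H \<and> (\<exists>t. (f, t) \<in> cover_ball R)}"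
    proof
      fix f assume "f \<in> g ` ?A"
      then obtain p where p: "f = g p" "p \<in> ?A" by blast
      have "0 \<in> {0..w (snd f)}"
        using weight_pos[OF universal_cover_edge_snd[OF g(1)[OF p(2)]]] p(1) by simp
      then have "(f, 0) \<in> cover_ball R" using g(5)[OF p(2)] p(1) by blast
      then show "f \<in> {f. f \<in> edges H \<and> (\<exists>t. (f, t) \<in> cover_ball R)}" using g(1) p by blast
    qed
  qed simp
  finally show ?thesis by simp
qed

end

end

section \<open>Volume entropy\<close>

text \<open>Fekete's lemma for a real parameter: the limit is the infimum \<open>L\<close> of
  \<open>g R / R\<close>. Monotonicity reduces arbitrary \<open>R\<close> to multiples of a fixed
  \<open>S\<close>.\<close>

lemma subadditive_growth_rate:
  fixes g :: "real \<Rightarrow> real"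
  assumes mono: "\<And>R S. 0 < R \<Longrightarrow> R \<le> S \<Longrightarrow> g R \<le> g S"
    and subadd: "\<And>R S. 0 < R \<Longrightarrow> 0 < S \<Longrightarrow> g (R + S) \<le> g R + g S"
    and nonneg: "\<And>R. 0 < R \<Longrightarrow> 0 \<le> g R"
  shows "\<exists>L\<ge>0. ((\<lambda>R. g R / R) \<longlongrightarrow> L) at_top"
proof -
  define L where "L = (INF R\<in>{0<..}. g R / R)"
  have nn: "0 \<le> g R / R" if "0 < R" for R using nonneg[OF that] that by simp
  have bdd: "bdd_below ((\<lambda>R. g R / R) ` {0<..})"
    using nn by (intro bdd_belowI2[where m = 0]) simp
  have L_le: "L \<le> g R / R" if "0 < R" for R
    unfolding L_def using that by (intro cINF_lower bdd) simp
  have "0 \<le> L" unfolding L_def using nn by (intro cINF_greatest) auto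
  have mult: "g (real (Suc n) * R) \<le> real (Suc n) * g R" if "0 < R" for n R
  proof (induction n)
    case (Suc n)
    have "g (real (Suc (Suc n)) * R) = g (real (Suc n) * R + R)"
      by (rule arg_cong[where f = g]) (simp add: algebra_simps)
    also have "\<dots> \<le> g (real (Suc n) * R) + g R"
      using that by (intro subadd) simp_all
    finally show ?case using Suc by (simp add: algebra_simps)
  qed simp
  \<comment> \<open>\<open>R\<close> is rounded up to a multiple of \<open>S\<close>; the rounding
    costs the term \<open>g S / R\<close>, which tends to 0.\<close>
  have upper: "g R / R \<le> g S / S + g S / R" if "0 < R" "0 < S" for R S
  proof -
    define n where "n = nat \<lfloor>R / S\<rfloor>"
    have pos: "0 \<le> R / S" using that by simp
    have n: "R / S \<le> real (Suc n)" "real n \<le> R / S"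
      unfolding n_def using pos by linarith+
    have "R \<le> real (Suc n) * S" using n(1) that by (simp add: field_simps)
    then have "g R \<le> g (real (Suc n) * S)" using that by (intro mono)
    also have "\<dots> \<le> real (Suc n) * g S" by (rule mult[OF that(2)])
    also have "\<dots> \<le> (R / S + 1) * g S"
      using n(2) nonneg[OF that(2)] by (intro mult_right_mono) simp_all
    finally have "g R / R \<le> (R / S + 1) * g S / R" using that by (simp add: divide_right_mono)
    also have "\<dots> = g S / S + g S / R" using that by (simp add: field_simps)
    finally show ?thesis .
  qed
  have "((\<lambda>R. g R / R) \<longlongrightarrow> L) at_top"
  proof (rule order_tendstoI)
    fix a assume "a < L"
    show "\<forall>\<^sub>F R in at_top. a < g R / R"
      using eventually_gt_at_top[of "0 :: real"]
    proof eventually_elim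
      case (elim R)
      then show ?case using L_le[OF elim] \<open>a < L\<close> by linarith
    qed
  next
    fix a assume "L < a"
    have "\<exists>S\<in>{0<..}. g S / S < a"
      using \<open>L < a\<close> unfolding L_def by (subst (asm) cINF_less_iff[OF _ bdd]) auto
    then obtain S where S: "0 < S" "g S / S < a" by auto
    have "((\<lambda>R. g S / S + g S / R) \<longlongrightarrow> g S / S + 0) at_top"
      by (intro tendsto_intros tendsto_divide_0[OF tendsto_const] filterlim_at_top_imp_at_infinity
        filterlim_ident)
    then have "\<forall>\<^sub>F R in at_top. g S / S + g S / R < a"
      using S(2) by (auto dest: order_tendstoD)
    then show "\<forall>\<^sub>F R in at_top. g R / R < a"
      using eventually_gt_at_top[of "0 :: real"]
    proof eventually_elim
      case (elim R)
      then show ?case using upper[OF elim(2) S(1)] by linarith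
    qed
  qed
  with \<open>0 \<le> L\<close> show ?thesis by blast
qed

text \<open>With \<open>g\<close> the logarithm of a count, constant factors and bounded changes of
  radius do not affect the growth rate.\<close>

lemma growth_rate_shift:
  fixes g :: "real \<Rightarrow> real"
  assumes "((\<lambda>R. g R / R) \<longlongrightarrow> L) at_top"
  shows "((\<lambda>R. (c + g (R + a)) / R) \<longlongrightarrow> L) at_top"
proof -
  have shift: "filterlim (\<lambda>R :: real. R + a) at_top at_top"
    using filterlim_tendsto_add_at_top[OF tendsto_const[of a] filterlim_ident]
    by (simp add: add.commute)
  have inv: "((\<lambda>R :: real. y / R) \<longlongrightarrow> 0) at_top" for y
    by (intro tendsto_divide_0[OF tendsto_const] filterlim_at_top_imp_at_infinity filterlim_ident)
  have "((\<lambda>R. c / R + g (R + a) / (R + a) * (1 + a / R)) \<longlongrightarrow> 0 + L * (1 + 0)) at_top"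
    by (intro tendsto_intros inv filterlim_compose[OF assms shift])
  moreover have "\<forall>\<^sub>F R in at_top. c / R + g (R + a) / (R + a) * (1 + a / R) = (c + g (R + a)) / R"
    using eventually_gt_at_top[of "max 0 (- a)"]
  proof eventually_elim
    case (elim R)
    then have "R \<noteq> 0" "R + a \<noteq> 0" by auto
    then have "g (R + a) / (R + a) * (1 + a / R) = g (R + a) / R" by (simp add: divide_simps)
    then show ?case by (simp add: add_divide_distrib)
  qed
  ultimately show ?thesis by (auto intro: Lim_transform_eventually)
qed

section \<open>The entropy as the growth rate of the number of reduced walks\<close>

context weighted_multigraph
begin

text \<open>Adding \<open>ln C\<close> to the logarithm of the count makes it subadditive, as
  \<open>C\<close> is the constant in \<open>card_all_rwalks_add\<close>. The constant is removed
  again in the limit.\<close>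

lemma all_rwalks_growth_rate:
  assumes "verts G \<noteq> {}"
  shows "\<exists>L\<ge>0. ((\<lambda>R. ln (real (card (all_rwalks R))) / R) \<longlongrightarrow> L) at_top"
proof -
  define C where "C = real (2 * card (edges G) + 1)"
  define M where "M R = real (card (all_rwalks R))" for R
  have C: "1 \<le> C" by (simp add: C_def)
  have M: "1 \<le> M R" if "0 < R" for R using card_all_rwalks_ge_1[OF assms that] by (simp add: M_def)
  have add: "M (R + S) \<le> C * (M R * M S)" if "0 < R" "0 < S" for R S
    using card_all_rwalks_add[OF assms that] unfolding M_def C_def of_nat_mult[symmetric] of_nat_le_iff .
  have "\<exists>L\<ge>0. ((\<lambda>R. (ln C + ln (M R)) / R) \<longlongrightarrow> L) at_top"
  proof (rule subadditive_growth_rate)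
    fix R S :: real assume R: "0 < R" "R \<le> S"
    then have "M R \<le> M S" by (simp add: M_def card_all_rwalks_mono)
    then show "ln C + ln (M R) \<le> ln C + ln (M S)" using M[OF R(1)] by simp
  next
    fix R S :: real assume R: "0 < R" "0 < S"
    have pos: "0 < C" "0 < M R" "0 < M S" "0 < M (R + S)" using C M[OF R(1)] M[OF R(2)] M[of "R + S"] R by auto
    then have "ln (M (R + S)) \<le> ln (C * (M R * M S))" using add[OF R] by (subst ln_le_cancel_iff) auto
    also have "\<dots> = ln C + (ln (M R) + ln (M S))" using pos by (simp add: ln_mult)
    finally show "ln C + ln (M (R + S)) \<le> ln C + ln (M R) + (ln C + ln (M S))" by simp
  next
    fix R :: real assume "0 < R"
    then show "0 \<le> ln C + ln (M R)" using C M[of R] by simp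
  qed
  then obtain L where L: "0 \<le> L" "((\<lambda>R. (ln C + ln (M R)) / R) \<longlongrightarrow> L) at_top" by blast
  from growth_rate_shift[OF L(2), of "- ln C" 0] have "((\<lambda>R. ln (M R) / R) \<longlongrightarrow> L) at_top" by simp
  with L(1) show ?thesis unfolding M_def by blast
qed

text \<open>Putting a fixed walk from \<open>v\<close> to \<open>u\<close> in front and reducing is
  injective by left cancellation, and lengthens walks by at most \<open>D\<close>.\<close>

lemma card_all_rwalks_le_rwalks:
  assumes "connected_graph G" "v \<in> verts G"
  shows "\<exists>D\<ge>0. \<forall>R. card (all_rwalks R) \<le> card (verts G) * card (rwalks v (R + D))"
proof -
  have "\<forall>u\<in>verts G. \<exists>p. walk G v p u" using assms unfolding connected_graph_def by blast
  from bchoice[OF this] obtain q where q: "\<And>u. u \<in> verts G \<Longrightarrow> walk G v (q u) u" by blast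
  define D where "D = (\<Sum>u\<in>verts G. walk_length w (q u))"
  have nn: "0 \<le> walk_length w (q u)" if "u \<in> verts G" for u
    using walk_length_walk_nonneg[OF q[OF that]] .
  have D: "walk_length w (q u) \<le> D" if "u \<in> verts G" for u
    unfolding D_def using that nn finite_verts by (intro member_le_sum) auto
  have shift: "card (rwalks u R) \<le> card (rwalks v (R + D))" if u: "u \<in> verts G" for u R
  proof (rule card_inj_on_le)
    show "inj_on (\<lambda>p. reduce (q u @ p)) (rwalks u R)"
    proof (rule inj_onI)
      fix p p' assume *: "p \<in> rwalks u R" "p' \<in> rwalks u R" "reduce (q u @ p) = reduce (q u @ p')"
      from reduce_append_cancel[OF *(3)] *(1,2) show "p = p'" by (simp add: rwalks_def reduce_reduced)
    qed
    show "(\<lambda>p. reduce (q u @ p)) ` rwalks u R \<subseteq> rwalks v (R + D)"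
    proof (rule image_subsetI)
      fix p assume "p \<in> rwalks u R"
      then obtain z where p: "walk G u p z" "walk_length w p < R" by (auto simp: rwalks_def)
      have "walk_length w (q u @ p) < R + D" using p(2) D[OF u] by simp
      then show "reduce (q u @ p) \<in> rwalks v (R + D)"
        by (rule reduced_in_rwalks[OF walk_appendI[OF q[OF u] p(1)]])
    qed
  qed simp
  have "card (all_rwalks R) \<le> card (verts G) * card (rwalks v (R + D))" for R
  proof -
    have "card (all_rwalks R) \<le> (\<Sum>u\<in>verts G. card (rwalks u R))"
      unfolding all_rwalks_def by (rule card_UN_le[OF finite_verts])
    also have "\<dots> \<le> (\<Sum>u\<in>verts G. card (rwalks v (R + D)))" using shift by (rule sum_mono)
    finally show ?thesis by simp
  qed
  moreover have "0 \<le> D" unfolding D_def using nn by (intro sum_nonneg) auto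
  ultimately show ?thesis by blast
qed

text \<open>The volume lies between \<open>c * M (R - 2 * W - D)\<close> and
  \<open>C * M (R + 2 * W)\<close>, and both bounds have growth rate \<open>L\<close>. This proves
  that the limit defining the entropy exists and is the same for every base point.\<close>

lemma volume_entropy_eqI:
  assumes conn: "connected_graph G" and x: "x \<in> points G w"
    and L: "((\<lambda>R. ln (real (card (all_rwalks R))) / R) \<longlongrightarrow> L) at_top"
  shows "volume_entropy G w x = L"
proof -
  obtain e0 t0 where x_eq: "x = (e0, t0)" by (cases x)
  have e0: "e0 \<in> edges G" and t0: "0 \<le> t0" "t0 \<le> w e0" using x by (auto simp: points_def x_eq)
  obtain m where m: "0 < m" "\<And>e. e \<in> edges G \<Longrightarrow> m \<le> w e" using min_weight by blast
  obtain W where W: "0 < W" "\<And>e. e \<in> edges G \<Longrightarrow> w e \<le> W" using max_weight by blast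
  let ?v = "ends G e0 False"
  have v: "?v \<in> verts G" using ends_in_verts[OF e0] .
  then have ne: "verts G \<noteq> {}" by blast
  obtain D where D: "0 \<le> D" "\<And>R. card (all_rwalks R) \<le> card (verts G) * card (rwalks ?v (R + D))"
    using card_all_rwalks_le_rwalks[OF conn v] by blast
  define M where "M R = real (card (all_rwalks R))" for R
  define V where "V R = graph_volume (universal_cover G ?v) (graph_ball (universal_cover G ?v)
    (lifted_weight w) ((homotopy_class G ?v [], e0), t0) R)" for R
  define c where "c = m / (2 * card (verts G))"
  define C where "C = W * card (edges G)"
  have cardV: "0 < card (verts G)" and cardE: "0 < card (edges G)"
    using v e0 finite_verts finite_edges by (auto simp: card_gt_0_iff)
  have c: "0 < c" and C: "0 < C" using m(1) W(1) cardV cardE by (simp_all add: c_def C_def)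
  have M1: "1 \<le> M R" if "0 < R" for R using card_all_rwalks_ge_1[OF ne that] by (simp add: M_def)
  have upper: "V R \<le> C * M (R + 2 * W)" if "0 < R" for R
    using graph_volume_ball_le[OF e0 t0 W that] by (simp add: V_def C_def M_def)
  have lower: "c * M (R + (- 2 * W - D)) \<le> V R" if "3 * W < R" for R
  proof -
    have "M (R + (- 2 * W - D)) \<le> real (card (verts G) * card (rwalks ?v (R - 2 * W)))"
      using D(2)[of "R + (- 2 * W - D)"] unfolding M_def of_nat_le_iff by simp
    then have "c * M (R + (- 2 * W - D)) \<le> c * real (card (verts G) * card (rwalks ?v (R - 2 * W)))"
      using c by (intro mult_left_mono) simp_all
    also have "\<dots> = m * card (rwalks ?v (R - 2 * W)) / 2" using cardV by (simp add: c_def field_simps)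
    also have "\<dots> \<le> V R"
      using graph_volume_ball_ge[OF e0 t0 W m that] by (simp add: V_def)
    finally show ?thesis .
  qed
  have L': "((\<lambda>R. ln (M R) / R) \<longlongrightarrow> L) at_top" using L unfolding M_def .
  have "((\<lambda>R. ln (V R) / R) \<longlongrightarrow> L) at_top"
  proof (rule tendsto_sandwich)
    show "((\<lambda>R. (ln c + ln (M (R + (- 2 * W - D)))) / R) \<longlongrightarrow> L) at_top"
      "((\<lambda>R. (ln C + ln (M (R + 2 * W))) / R) \<longlongrightarrow> L) at_top"
      by (rule growth_rate_shift[OF L'])+
    \<comment> \<open>Beyond this radius the lower estimate applies and all arguments of
      \<open>M\<close> are positive, so the logarithms are taken of positive numbers.\<close>
    have ev: "\<forall>\<^sub>F R in at_top. 3 * W + D < R" by (rule eventually_gt_at_top)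
    show "\<forall>\<^sub>F R in at_top. (ln c + ln (M (R + (- 2 * W - D)))) / R \<le> ln (V R) / R"
      using ev
    proof eventually_elim
      case (elim R)
      then have R: "0 < R" "3 * W < R" "0 < R + (- 2 * W - D)" using W(1) D(1) by linarith+
      have pos: "0 < M (R + (- 2 * W - D))" using M1[OF R(3)] by simp
      then have "ln c + ln (M (R + (- 2 * W - D))) = ln (c * M (R + (- 2 * W - D)))"
        using c by (simp add: ln_mult)
      also have "\<dots> \<le> ln (V R)"
        using lower[OF R(2)] mult_pos_pos[OF c pos] by (intro ln_mono) auto
      finally show ?case using R(1) by (simp add: divide_right_mono)
    qed
    show "\<forall>\<^sub>F R in at_top. ln (V R) / R \<le> (ln C + ln (M (R + 2 * W))) / R"
      using ev
    proof eventually_elim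
      case (elim R)
      then have R: "0 < R" "3 * W < R" "0 < R + (- 2 * W - D)" "0 < R + 2 * W" using W(1) D(1) by linarith+
      have "0 < c * M (R + (- 2 * W - D))" using c M1[OF R(3)] by simp
      then have V: "0 < V R" using lower[OF R(2)] by linarith
      have pos: "0 < M (R + 2 * W)" using M1[OF R(4)] by simp
      have "ln (V R) \<le> ln (C * M (R + 2 * W))" using upper[OF R(1)] V by (intro ln_mono) auto
      also have "\<dots> = ln C + ln (M (R + 2 * W))" using C pos by (simp add: ln_mult)
      finally show ?case using R(1) by (simp add: divide_right_mono)
    qed
  qed
  then show ?thesis
    unfolding volume_entropy_def Let_def x_eq fst_conv snd_conv V_def
    by (intro tendsto_Lim) simp_all
qed

text \<open>The limit \<open>L\<close> is evaluated along the multiples of \<open>s / 2\<close>,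
  where the count grows at most by the factor \<open>(2 * b + 1) * (2 * b)\<close> per step. Any
  positive lower bound \<open>s\<close> for the lengths of nonempty reduced closed walks is
  allowed.\<close>

lemma growth_rate_le:
  assumes conn: "connected_graph G" and b: "betti_number G = int b" "1 \<le> b"
    and girth: "\<And>u p. walk G u p u \<Longrightarrow> reduced p \<Longrightarrow> p \<noteq> [] \<Longrightarrow> s \<le> walk_length w p" and s: "0 < s"
    and L: "((\<lambda>R. ln (real (card (all_rwalks R))) / R) \<longlongrightarrow> L) at_top"
  shows "L * s \<le> 2 * ln (real ((2 * b + 1) * (2 * b)))"
proof -
  obtain F where F: "F \<subseteq> edges G" "card F + 1 = card (verts G)"
    "\<And>u p. walk G u p u \<Longrightarrow> reduced p \<Longrightarrow> fst ` set p \<subseteq> F \<Longrightarrow> p = []"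
    using spanning_tree[OF finite_multigraph conn] by blast
  have "card (edges G - F) = card (edges G) - card F" "card F \<le> card (edges G)"
    using F(1) finite_edges by (simp_all add: card_Diff_subset finite_subset card_mono)
  then have chords: "card (edges G - F) = b" using b(1) F(2) by (simp add: betti_number_def)
  define n where "n = real (card (verts G))"
  define K where "K = real ((2 * b + 1) * (2 * b))"
  \<comment> \<open>The successor keeps \<open>r k\<close> positive, so that division by it is
    safe.\<close>
  define r where "r k = real (Suc k) * (s / 2)" for k
  have n: "1 \<le> n" using F(2) by (simp add: n_def)
  have "1 \<le> (2 * b + 1) * (2 * b)" using b(2) by simp
  then have K: "1 \<le> K" unfolding K_def by linarith
  have ne: "verts G \<noteq> {}" using conn by (simp add: connected_graph_def)
  have r: "0 < r k" for k using s by (simp add: r_def)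
  have "filterlim (\<lambda>k. real (Suc k)) at_top sequentially"
    by (rule filterlim_compose[OF filterlim_real_sequentially filterlim_Suc])
  then have "filterlim (\<lambda>k. (s / 2) * real (Suc k)) at_top sequentially"
    using s by (intro filterlim_tendsto_pos_mult_at_top[OF tendsto_const]) simp_all
  then have r_top: "filterlim r at_top sequentially" unfolding r_def by (simp add: mult.commute)
  have "(\<lambda>k. ln (real (card (all_rwalks (r k)))) / r k) \<longlonglongrightarrow> L"
    by (rule filterlim_compose[OF L r_top])
  moreover have "(\<lambda>k. 2 * ln n / r k + 2 * ln K / s) \<longlonglongrightarrow> 0 + 2 * ln K / s"
    by (intro tendsto_intros tendsto_divide_0[OF tendsto_const] filterlim_at_top_imp_at_infinity r_top)
  moreover have "ln (real (card (all_rwalks (r k)))) / r k \<le> 2 * ln n / r k + 2 * ln K / s" for k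
  proof -
    have "card (all_rwalks (r k)) \<le> card (verts G) ^ 2 * ((2 * b + 1) * (2 * b)) ^ Suc k"
      unfolding r_def by (rule card_all_rwalks_le[OF F(3) chords girth s b(2)])
    then have "real (card (all_rwalks (r k))) \<le> real (card (verts G) ^ 2 * ((2 * b + 1) * (2 * b)) ^ Suc k)"
      unfolding of_nat_le_iff .
    also have "\<dots> = n ^ 2 * K ^ Suc k" unfolding n_def K_def by (simp only: of_nat_mult of_nat_power)
    finally have "ln (real (card (all_rwalks (r k)))) \<le> ln (n ^ 2 * K ^ Suc k)"
      using card_all_rwalks_ge_1[OF ne r[of k]] by (intro ln_mono) auto
    also have "\<dots> = 2 * ln n + real (Suc k) * ln K"
      using n K by (simp add: ln_mult ln_realpow del: power_Suc of_nat_Suc)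
    finally have "ln (real (card (all_rwalks (r k)))) / r k \<le> (2 * ln n + real (Suc k) * ln K) / r k"
      using r[of k] by (intro divide_right_mono) simp_all
    also have "real (Suc k) * ln K / r k = 2 * ln K / s"
      using s unfolding r_def by (simp add: field_simps del: of_nat_Suc)
    then have "(2 * ln n + real (Suc k) * ln K) / r k = 2 * ln n / r k + 2 * ln K / s"
      by (simp only: add_divide_distrib)
    finally show ?thesis .
  qed
  ultimately have "L \<le> 0 + 2 * ln K / s" by (intro LIMSEQ_le) auto
  then show ?thesis using s unfolding K_def[symmetric] by (simp add: field_simps)
qed

end

theorem theorem1:
  fixes G :: "('v, 'e) multigraph" and w :: "'e \<Rightarrow> real" and b :: nat and x :: "'e \<times> real"
  assumes "finite_multigraph G" and "connected_graph G" and "weight_function G w"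
    and "betti_number G = int b" and "b \<ge> 1"
    and "x \<in> points G w"
  shows "volume_entropy G w x * systole G w \<le> 2 * ln (8 * real b ^ 3 - 1)"
proof -
  interpret weighted_multigraph G w using assms by unfold_locales
  let ?K = "real ((2 * b + 1) * (2 * b))" and ?K' = "8 * real b ^ 3 - 1"
  have "verts G \<noteq> {}" using assms by (simp add: connected_graph_def)
  then obtain L where L: "0 \<le> L" "((\<lambda>R. ln (real (card (all_rwalks R))) / R) \<longlongrightarrow> L) at_top"
    using all_rwalks_growth_rate by blast
  have entropy: "volume_entropy G w x = L" using volume_entropy_eqI assms L(2) by blast
  obtain t where t: "b = Suc t" using assms by (cases b) auto
  \<comment> \<open>With \<open>b = t + 1\<close>, the difference \<open>?K' - ?K\<close> is this
    polynomial plus 1.\<close>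
  have "0 \<le> 14 * real t + 20 * (real t)\<^sup>2 + 8 * real t ^ 3" by simp
  then have K: "?K \<le> ?K'" unfolding t
    by (simp add: power2_eq_square power3_eq_cube algebra_simps)
  have K1: "1 \<le> ?K" unfolding t by simp
  then have ln_K: "0 \<le> ln ?K'" "ln ?K \<le> ln ?K'" using K by simp_all
  have bound: "L * s \<le> 2 * ln ?K'"
    if "0 < s" "\<And>u p. walk G u p u \<Longrightarrow> reduced p \<Longrightarrow> p \<noteq> [] \<Longrightarrow> s \<le> walk_length w p" for s
  proof -
    have "L * s \<le> 2 * ln ?K"
      by (rule growth_rate_le[OF assms(2,4,5) _ that(1) L(2)]) (rule that(2))
    then show ?thesis using ln_K(2) by linarith
  qed
  let ?S = "{walk_length w p | u p. walk G u p u \<and> \<not> homotopic_walks G u p []}"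
  \<comment> \<open>A nonempty reduced walk is its own reduction, which differs from that of the
    trivial walk.\<close>
  have in_S: "walk_length w p \<in> ?S" if "walk G u p u" "reduced p" "p \<noteq> []" for u p
    using that homotopic_walks_iff[OF that(1), of "[]"] reduce_reduced[OF that(2)] by auto
  \<comment> \<open>If \<open>?S\<close> is empty, the systole is a junk value, but the bound on cycles is then vacuous.\<close>
  have "bdd_below ?S" using walk_length_walk_nonneg by (intro bdd_belowI[of _ 0]) auto
  then have girth: "systole G w \<le> walk_length w p" if "walk G u p u" "reduced p" "p \<noteq> []" for u p
    unfolding systole_def using in_S[OF that] by (rule cInf_lower[rotated])
  show ?thesis
  proof (cases "0 < systole G w")
    case True
    then show ?thesis using bound[OF True girth] entropy by simp
  next
    \<comment> \<open>For a nonpositive value of the systole, the product is at most 0 because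
      \<open>L\<close> is nonnegative, while the right-hand side is nonnegative.\<close>
    case False
    then have "L * systole G w \<le> 0" using L(1) by (simp add: mult_nonneg_nonpos)
    then show ?thesis using ln_K(1) entropy by simp
  qed
qed

end
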